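(* Let $m\ge n$, let $H,H_1,\dots,H_p\in\mathbb{C}^{m\times n}$ with $H$ of full column rank, $y,y_1,\dots,y_p\in\mathbb{C}^m$, and $\delta_\alpha,\delta_\beta\ge 0$. With $\kappa$, $d$, $b$, $G$, $Q$ and the structured approximate regret $R_s$ as in the context, for every $x\in\mathbb{C}^n$ and $\gamma\in\mathbb{R}$, $R_s(x;\alpha,\beta)\le\gamma$ holds for all $\alpha,\beta\in\mathbb{C}^p$ with $\|\alpha\|\le\delta_\alpha$, $\|\beta\|\le\delta_\beta$ if and only if there exist $\tau_1,\tau_2\ge 0$ with $$\begin{bmatrix} \gamma+\kappa-\tau_1-\tau_2 & (y-Hx)^H & \delta_\alpha d^H & \delta_\beta b^H\\ y-Hx & I_m & -\delta_\alpha G & \delta_\beta Q\\ \delta_\alpha d & -\delta_\alpha G^H & \tau_1 I_p & 0\\ \delta_\beta b & \delta_\beta Q^H & 0 & \tau_2 I_p \end{bmatrix}\succeq 0 .$$ Consequently, $\min_{x}\max_{\|\alpha\|\le\delta_\alpha,\|\beta\|\le\delta_\beta}R_s(x;\alpha,\beta)$ equals the optimal value of minimizing $\gamma$ over $(\gamma,x,\tau_1,\tau_2)$ subject to $\tau_1,\tau_2\ge0$ and this matrix inequality.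
   Context: For $\alpha=(\alpha_1,\dots,\alpha_p)^T,\beta=(\beta_1,\dots,\beta_p)^T\in\mathbb{C}^p$ the structured perturbed data are $\tilde H = H+\sum_{i=1}^p\alpha_iH_i$ and $\tilde y = y+\sum_{i=1}^p\beta_iy_i$. Let $H^+$ be the Moore–Penrose pseudo-inverse, $P = I_m - HH^+$, $\kappa = y^HPy$, $d\in\mathbb{C}^p$ with $d_i = -\overline{y^HPH_iH^+y}$, and $b\in\mathbb{C}^p$ with $b_i = \overline{y^HPy_i}$. Let $G = [H_1x,\dots,H_px]\in\mathbb{C}^{m\times p}$ and $Q=[y_1,\dots,y_p]\in\mathbb{C}^{m\times p}$. The structured approximate regret is $$R_s(x;\alpha,\beta) = \|\tilde y-\tilde Hx\|^2 - \big(\kappa + d^H\alpha+\alpha^Hd + b^H\beta+\beta^Hb\big).$$ $\|\cdot\|$ is the Euclidean norm; $A\succeq 0$ means Hermitian positive semidefinite. *)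

theory Defs
  imports "Jordan_Normal_Form.Schur_Decomposition" "Jordan_Normal_Form.DL_Rank"
begin

definition vherm :: "complex vec \<Rightarrow> complex vec \<Rightarrow> complex" where
  "vherm u v = (\<Sum>i<dim_vec u. cnj (u $ i) * v $ i)"

definition vnorm :: "complex vec \<Rightarrow> real" where
  "vnorm v = sqrt (\<Sum>i<dim_vec v. (cmod (v $ i))\<^sup>2)"

definition psd :: "complex mat \<Rightarrow> bool" where
  "psd A \<longleftrightarrow> A \<in> carrier_mat (dim_row A) (dim_row A) \<and> mat_adjoint A = A \<and>
     (\<forall>v \<in> carrier_vec (dim_row A). 0 \<le> Re (vherm v (A *\<^sub>v v)))"

definition mp_pinv :: "complex mat \<Rightarrow> complex mat" where
  "mp_pinv H = (THE X. X \<in> carrier_mat (dim_col H) (dim_row H) \<and>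
      H * X * H = H \<and> X * H * X = X \<and>
      mat_adjoint (H * X) = H * X \<and> mat_adjoint (X * H) = X * H)"

definition projP :: "complex mat \<Rightarrow> complex mat" where
  "projP H = 1\<^sub>m (dim_row H) - H * mp_pinv H"

definition kappa :: "complex mat \<Rightarrow> complex vec \<Rightarrow> complex" where
  "kappa H y = vherm y (projP H *\<^sub>v y)"

definition dvec :: "complex mat \<Rightarrow> (nat \<Rightarrow> complex mat) \<Rightarrow> complex vec \<Rightarrow> nat \<Rightarrow> complex vec" where
  "dvec H Hs y p = vec p (\<lambda>i. - cnj (vherm y (projP H * Hs i * mp_pinv H *\<^sub>v y)))"

definition bvec :: "complex mat \<Rightarrow> (nat \<Rightarrow> complex vec) \<Rightarrow> complex vec \<Rightarrow> nat \<Rightarrow> complex vec" where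
  "bvec H ys y p = vec p (\<lambda>i. cnj (vherm y (projP H *\<^sub>v ys i)))"

text \<open>G = [H_1 x, ..., H_p x] and Q = [y_1, ..., y_p] (indices shifted to 0..p-1).\<close>
definition Gmat :: "(nat \<Rightarrow> complex mat) \<Rightarrow> complex vec \<Rightarrow> nat \<Rightarrow> nat \<Rightarrow> complex mat" where
  "Gmat Hs x m p = mat m p (\<lambda>(j, i). (Hs i *\<^sub>v x) $ j)"

definition Qmat :: "(nat \<Rightarrow> complex vec) \<Rightarrow> nat \<Rightarrow> nat \<Rightarrow> complex mat" where
  "Qmat ys m p = mat m p (\<lambda>(j, i). ys i $ j)"

definition Htil :: "complex mat \<Rightarrow> (nat \<Rightarrow> complex mat) \<Rightarrow> nat \<Rightarrow> complex vec \<Rightarrow> complex mat" where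
  "Htil H Hs p \<alpha> = mat (dim_row H) (dim_col H)
     (\<lambda>(j, k). H $$ (j, k) + (\<Sum>i<p. \<alpha> $ i * Hs i $$ (j, k)))"

definition ytil :: "complex vec \<Rightarrow> (nat \<Rightarrow> complex vec) \<Rightarrow> nat \<Rightarrow> complex vec \<Rightarrow> complex vec" where
  "ytil y ys p \<beta> = vec (dim_vec y) (\<lambda>j. y $ j + (\<Sum>i<p. \<beta> $ i * ys i $ j))"

text \<open>Structured approximate regret. The subtracted quantity is real (kappa is real and
  the other terms come in conjugate pairs); we take its real part.\<close>
definition Rs :: "complex mat \<Rightarrow> (nat \<Rightarrow> complex mat) \<Rightarrow> complex vec \<Rightarrow> (nat \<Rightarrow> complex vec) \<Rightarrow> nat
    \<Rightarrow> complex vec \<Rightarrow> complex vec \<Rightarrow> complex vec \<Rightarrow> real" where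
  "Rs H Hs y ys p x \<alpha> \<beta> =
     (vnorm (ytil y ys p \<beta> - Htil H Hs p \<alpha> *\<^sub>v x))\<^sup>2
     - Re (kappa H y + vherm (dvec H Hs y p) \<alpha> + vherm \<alpha> (dvec H Hs y p)
           + vherm (bvec H ys y p) \<beta> + vherm \<beta> (bvec H ys y p))"

definition colm :: "complex vec \<Rightarrow> complex mat" where
  "colm v = mat (dim_vec v) 1 (\<lambda>(i, _). v $ i)"

definition rowH :: "complex vec \<Rightarrow> complex mat" where
  "rowH v = mat 1 (dim_vec v) (\<lambda>(_, i). cnj (v $ i))"

definition LMI :: "complex mat \<Rightarrow> (nat \<Rightarrow> complex mat) \<Rightarrow> complex vec \<Rightarrow> (nat \<Rightarrow> complex vec) \<Rightarrow> nat
    \<Rightarrow> real \<Rightarrow> real \<Rightarrow> real \<Rightarrow> complex vec \<Rightarrow> real \<Rightarrow> real \<Rightarrow> complex mat" where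
  "LMI H Hs y ys p \<delta>a \<delta>b \<gamma> x \<tau>1 \<tau>2 =
    (let m = dim_row H; r = y - H *\<^sub>v x; d = dvec H Hs y p; b = bvec H ys y p;
         G = Gmat Hs x m p; Q = Qmat ys m p;
         da = complex_of_real \<delta>a; db = complex_of_real \<delta>b;
         A11 = four_block_mat
                 (mat 1 1 (\<lambda>_. complex_of_real \<gamma> + kappa H y - complex_of_real \<tau>1 - complex_of_real \<tau>2))
                 (rowH r) (colm r) (1\<^sub>m m);
         A12 = four_block_mat (da \<cdot>\<^sub>m rowH d) (db \<cdot>\<^sub>m rowH b) (- (da \<cdot>\<^sub>m G)) (db \<cdot>\<^sub>m Q);
         A21 = four_block_mat (da \<cdot>\<^sub>m colm d) (- (da \<cdot>\<^sub>m mat_adjoint G))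
                              (db \<cdot>\<^sub>m colm b) (db \<cdot>\<^sub>m mat_adjoint Q);
         A22 = four_block_mat (complex_of_real \<tau>1 \<cdot>\<^sub>m 1\<^sub>m p) (0\<^sub>m p p) (0\<^sub>m p p) (complex_of_real \<tau>2 \<cdot>\<^sub>m 1\<^sub>m p)
     in four_block_mat A11 A12 A21 A22)"

definition WCRs :: "complex mat \<Rightarrow> (nat \<Rightarrow> complex mat) \<Rightarrow> complex vec \<Rightarrow> (nat \<Rightarrow> complex vec) \<Rightarrow> nat
    \<Rightarrow> real \<Rightarrow> real \<Rightarrow> complex vec \<Rightarrow> real" where
  "WCRs H Hs y ys p \<delta>a \<delta>b x = Sup {Rs H Hs y ys p x \<alpha> \<beta> | \<alpha> \<beta>.
      \<alpha> \<in> carrier_vec p \<and> \<beta> \<in> carrier_vec p \<and> vnorm \<alpha> \<le> \<delta>a \<and> vnorm \<beta> \<le> \<delta>b}"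

end

theory Submission
  imports "HOL-Analysis.Analysis" Defs
begin

text \<open>
  Write r = y - Hx. Since R_s(x; \<alpha>, \<beta>) = |r - G\<alpha> + Q\<beta>|^2 - \<kappa> - 2 Re d^H \<alpha> - 2 Re b^H \<beta>, completing the
  square in the I_m block shows that, at a vector (t, u, ta, tc), the quadratic form of the block
  matrix equals |t|^2 (\<gamma> - R_s(x; \<delta>_\<alpha> a, \<delta>_\<beta> c) - \<tau>1 (1 - |a|^2) - \<tau>2 (1 - |c|^2)) plus |u + t w|^2,
  where w = r - \<delta>_\<alpha> Ga + \<delta>_\<beta> Qc is the perturbed residual. Hence the matrix inequality is the dual
  certificate of the S-lemma for the constraints |ta| \<le> |t| and |tc| \<le> |t|. The S-lemma with two
  constraints is lossless over the complex numbers because the joint image of three Hermitian forms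
  is a convex cone, so that it can be separated from the set of violating values. Scaling by
  \<delta>_\<alpha>, \<delta>_\<beta> beforehand makes the Slater condition hold even when these radii vanish.
  The minimum over x exists because the worst-case regret is a supremum of functions continuous in x
  and is at least |y - Hx|^2 - \<kappa>, which is coercive when H has full column rank.
\<close>

unbundle no vec_syntax and no inner_syntax

section \<open>Hermitian maps and the complex S-lemma\<close>

text \<open>
  The Hermitian matrix D with diagonal (e, f) and off-diagonal entry w is nonzero, so along the line
  I + s D, starting at I, one meets a singular positive semidefinite matrix, which has rank at most one.
\<close>

lemma rank_one_scaling:
  fixes e f :: real and w :: complex
  assumes "e \<noteq> 0 \<or> f \<noteq> 0 \<or> w \<noteq> 0"
  obtains s u v where "(cmod u)\<^sup>2 = 1 + s * e" "(cmod v)\<^sup>2 = 1 + s * f" "cnj u * v = of_real s * w"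
proof -
  \<comment> \<open>\<open>\<phi>\<close> is the determinant of I + s D. A zero s with |s| *
    \<open>M\<close> at most 1 also keeps both diagonal entries nonnegative, so the singular matrix
    is positive semidefinite.\<close>
  define \<phi> where "\<phi> = (\<lambda>s. (1 + s * e) * (1 + s * f) - s\<^sup>2 * (cmod w)\<^sup>2)"
  define M where "M = max \<bar>e\<bar> \<bar>f\<bar>"
  have \<phi>0: "\<phi> 0 = 1" by (simp add: \<phi>_def)
  have cont: "continuous_on A \<phi>" for A
    unfolding \<phi>_def by (intro continuous_intros)
  have "\<exists>s. \<phi> s = 0 \<and> \<bar>s\<bar> * M \<le> 1"
  proof (cases "M = 0")
    case True
    then have "e = 0" "f = 0" by (auto simp: M_def max_def split: if_splits)
    then show ?thesis using True assms
      by (intro exI[of _ "1 / cmod w"]) (simp add: \<phi>_def power_divide)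
  next
    case False
    then have M: "M > 0" by (auto simp: M_def)
    \<comment> \<open>Taking s0 = -1/e or -1/f for the diagonal entry of larger modulus makes one
      diagonal entry of I + s0 D vanish, so \<open>\<phi> s0\<close> = -s0^2 |w|^2. The intermediate
      value theorem between 0 and s0 gives the zero.\<close>
    obtain s0 where s0: "\<bar>s0\<bar> * M \<le> 1" "\<phi> s0 \<le> 0"
    proof (cases "\<bar>f\<bar> \<le> \<bar>e\<bar>")
      case True
      then have "M = \<bar>e\<bar>" "e \<noteq> 0" using M by (auto simp: M_def)
      then show ?thesis by (intro that[of "-1/e"]) (auto simp: \<phi>_def)
    next
      case False
      then have "M = \<bar>f\<bar>" "f \<noteq> 0" using M by (auto simp: M_def)
      then show ?thesis by (intro that[of "-1/f"]) (auto simp: \<phi>_def)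
    qed
    obtain s where s: "\<phi> s = 0" "\<bar>s\<bar> \<le> \<bar>s0\<bar>"
    proof (cases "0 \<le> s0")
      case True
      then show ?thesis
        using IVT2'[of \<phi> s0 0 0] s0 \<phi>0 cont that by force
    next
      case False
      then show ?thesis
        using IVT'[of \<phi> s0 0 0] s0 \<phi>0 cont that by force
    qed
    have "\<bar>s\<bar> * M \<le> \<bar>s0\<bar> * M" using s(2) M by (intro mult_right_mono) auto
    with s s0 show ?thesis by force
  qed
  then obtain s where s: "\<phi> s = 0" "\<bar>s\<bar> * M \<le> 1" by blast
  have bound: "0 \<le> 1 + s * t" if "\<bar>t\<bar> \<le> M" for t
  proof -
    have "\<bar>s * t\<bar> \<le> \<bar>s\<bar> * M" unfolding abs_mult using that by (intro mult_left_mono) auto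
    then show ?thesis using s(2) by linarith
  qed
  have e: "0 \<le> 1 + s * e" and f: "0 \<le> 1 + s * f"
    by (auto intro!: bound simp: M_def)
  have det: "(1 + s * e) * (1 + s * f) = (cmod (of_real s * w))\<^sup>2"
    using s(1) by (simp add: \<phi>_def norm_mult power_mult_distrib)
  \<comment> \<open>Rank-one factorisation of the singular matrix. If the first diagonal entry
    vanishes, so does the off-diagonal one; otherwise u is the root of that entry and v is
    determined by the off-diagonal one.\<close>
  show ?thesis
  proof (cases "1 + s * e = 0")
    case True
    then have "of_real s * w = 0" using det by simp
    then show ?thesis
      using True f by (intro that[of 0 s "of_real (sqrt (1 + s * f))"]) auto
  next
    case False
    define r where "r = sqrt (1 + s * e)"
    have r: "r > 0" "r\<^sup>2 = 1 + s * e" using False e by (auto simp: r_def)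
    have "(cmod (of_real s * w / of_real r))\<^sup>2 = 1 + s * f"
      using det r False by (simp add: norm_divide power_divide field_simps)
    then show ?thesis
      using r by (intro that[of "of_real r" s "of_real s * w / of_real r"]) auto
  qed
qed

text \<open>
  The behaviour of a tuple of Hermitian forms on the span of two vectors, with z in the role of
  u x + v y; no vector space structure on the carrier is needed.
\<close>

definition hermitian_map_on :: "'a set \<Rightarrow> ('a \<Rightarrow> 'b::real_vector) \<Rightarrow> bool" where
  "hermitian_map_on V q \<longleftrightarrow> (\<forall>x\<in>V. \<forall>y\<in>V. \<exists>h :: complex \<Rightarrow> 'b. linear h \<and>
     (\<forall>u v. \<exists>z\<in>V. q z = (cmod u)\<^sup>2 *\<^sub>R q x + (cmod v)\<^sup>2 *\<^sub>R q y + h (cnj u * v)))"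

text \<open>The choice u = sqrt c, v = 0 removes the off-diagonal term.\<close>

lemma hermitian_map_on_scale:
  assumes q: "hermitian_map_on V q" and x: "x \<in> V" and c: "0 \<le> c"
  obtains z where "z \<in> V" "q z = c *\<^sub>R q x"
proof -
  obtain h :: "complex \<Rightarrow> 'b" where h: "linear h"
    "\<And>u v. \<exists>z\<in>V. q z = (cmod u)\<^sup>2 *\<^sub>R q x + (cmod v)\<^sup>2 *\<^sub>R q x + h (cnj u * v)"
    using q x unfolding hermitian_map_on_def by blast
  show ?thesis
    using h(2)[of "of_real (sqrt c)" 0] that linear_0[OF h(1)] c by auto
qed

text \<open>The sum is the value at the identity of a linear map \<open>g\<close> on 2 x 2 Hermitian
  matrices, while elements of \<open>V\<close> realise its values at rank-one matrices. A kernel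
  direction of \<open>g\<close> leads from the identity to a matrix of rank at most one without
  changing the value.\<close>

lemma hermitian_map_on_add:
  fixes q :: "'a \<Rightarrow> 'b::euclidean_space"
  assumes q: "hermitian_map_on V q" and dim: "DIM('b) \<le> 3" and x: "x \<in> V" and y: "y \<in> V"
  obtains z where "z \<in> V" "q z = q x + q y"
proof -
  obtain h :: "complex \<Rightarrow> 'b" where h: "linear h"
    and comb: "\<And>u v. \<exists>z\<in>V. q z = (cmod u)\<^sup>2 *\<^sub>R q x + (cmod v)\<^sup>2 *\<^sub>R q y + h (cnj u * v)"
    using q x y unfolding hermitian_map_on_def by blast
  define g :: "real \<times> real \<times> complex \<Rightarrow> 'b" where
    "g = (\<lambda>t. fst t *\<^sub>R q x + fst (snd t) *\<^sub>R q y + h (snd (snd t)))"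
  have g: "linear g"
    unfolding g_def by (rule linearI) (simp_all add: algebra_simps linear_add[OF h] linear_scale[OF h])
  \<comment> \<open>2 x 2 Hermitian matrices have real dimension 4, one more than the number of forms.\<close>
  have "\<not> inj g"
  proof
    assume "inj g"
    then have "dim (range g) = DIM(real \<times> real \<times> complex)"
      using dim_image_eq[OF g, of UNIV] by simp
    moreover have "dim (range g) \<le> DIM('b)" by (rule dim_subset_UNIV)
    ultimately show False using dim by simp
  qed
  then obtain t where "t \<noteq> 0" "g t = 0"
    using linear_injective_0[OF g] by blast
  then obtain e f w where t: "e \<noteq> 0 \<or> f \<noteq> 0 \<or> w \<noteq> 0" and gt: "e *\<^sub>R q x + f *\<^sub>R q y + h w = 0"
    by (cases t) (auto simp: g_def zero_prod_def)
  obtain s u v where s: "(cmod u)\<^sup>2 = 1 + s * e" "(cmod v)\<^sup>2 = 1 + s * f" "cnj u * v = of_real s * w"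
    using rank_one_scaling[OF t] .
  obtain z where z: "z \<in> V" "q z = (cmod u)\<^sup>2 *\<^sub>R q x + (cmod v)\<^sup>2 *\<^sub>R q y + h (cnj u * v)"
    using comb by blast
  have "q z = q x + q y + s *\<^sub>R (e *\<^sub>R q x + f *\<^sub>R q y + h w)"
    unfolding z(2) s using linear_scale[OF h, of s w]
    by (simp add: scaleR_conv_of_real algebra_simps)
  then show ?thesis using that z(1) gt by simp
qed

text \<open>Allows constraint forms to be introduced as differences of other forms.\<close>

lemma hermitian_map_on_linear:
  assumes q: "hermitian_map_on V q" and L: "linear L"
  shows "hermitian_map_on V (\<lambda>z. L (q z))"
  unfolding hermitian_map_on_def
proof (intro ballI)
  fix x y assume "x \<in> V" "y \<in> V"
  then obtain h where h: "linear h"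
    and comb: "\<And>u v. \<exists>z\<in>V. q z = (cmod u)\<^sup>2 *\<^sub>R q x + (cmod v)\<^sup>2 *\<^sub>R q y + h (cnj u * v)"
    using q unfolding hermitian_map_on_def by blast
  have "linear (L \<circ> h)" using h L by (rule linear_compose)
  moreover have "\<exists>z\<in>V. L (q z) = (cmod u)\<^sup>2 *\<^sub>R L (q x) + (cmod v)\<^sup>2 *\<^sub>R L (q y) + (L \<circ> h) (cnj u * v)" for u v
  proof -
    obtain z where z: "z \<in> V" "q z = (cmod u)\<^sup>2 *\<^sub>R q x + (cmod v)\<^sup>2 *\<^sub>R q y + h (cnj u * v)"
      using comb by blast
    have "L (q z) = (cmod u)\<^sup>2 *\<^sub>R L (q x) + (cmod v)\<^sup>2 *\<^sub>R L (q y) + (L \<circ> h) (cnj u * v)"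
      unfolding z(2) by (simp add: linear_add[OF L] linear_scale[OF L])
    then show ?thesis using z(1) by blast
  qed
  ultimately show "\<exists>h. linear h \<and> (\<forall>u v. \<exists>z\<in>V.
      L (q z) = (cmod u)\<^sup>2 *\<^sub>R L (q x) + (cmod v)\<^sup>2 *\<^sub>R L (q y) + h (cnj u * v))"
    by blast
qed

text \<open>Closure under nonnegative multiples and under sums makes the image a convex cone. This
  is the complex counterpart of Dines's theorem on two real quadratic forms; over the complex
  numbers three forms are possible.\<close>

lemma convex_hermitian_image:
  fixes q :: "'a \<Rightarrow> 'b::euclidean_space"
  assumes q: "hermitian_map_on V q" and dim: "DIM('b) \<le> 3"
  shows "convex (q ` V)"
proof (rule convexI, clarify)
  fix x y and a b :: real
  assume "x \<in> V" "y \<in> V" "0 \<le> a" "0 \<le> b"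
  then obtain x' y' where "x' \<in> V" "q x' = a *\<^sub>R q x" "y' \<in> V" "q y' = b *\<^sub>R q y"
    using hermitian_map_on_scale[OF q] by metis
  then show "a *\<^sub>R q x + b *\<^sub>R q y \<in> q ` V"
    using hermitian_map_on_add[OF q dim] by (metis imageI)
qed

text \<open>A hyperplane separates the image from the set \<open>T\<close> of values that violate
  the implication; the multipliers are ratios of the coordinates of its normal.\<close>

lemma complex_S_lemma:
  fixes F g1 g2 :: "'a \<Rightarrow> real"
  assumes q: "hermitian_map_on V (\<lambda>z. (F z, g1 z, g2 z))"
    and impl: "\<And>z. z \<in> V \<Longrightarrow> 0 \<le> g1 z \<Longrightarrow> 0 \<le> g2 z \<Longrightarrow> 0 \<le> F z"
    and slater: "z0 \<in> V" "0 < g1 z0" "0 < g2 z0"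
  obtains \<tau>1 \<tau>2 where "0 \<le> \<tau>1" "0 \<le> \<tau>2" "\<And>z. z \<in> V \<Longrightarrow> \<tau>1 * g1 z + \<tau>2 * g2 z \<le> F z"
proof -
  let ?q = "\<lambda>z. (F z, g1 z, g2 z)"
  define T :: "(real \<times> real \<times> real) set" where "T = {..<0} \<times> {0..} \<times> {0..}"
  have T: "convex T" "T \<noteq> {}" "T \<inter> ?q ` V = {}"
    using impl by (auto simp: T_def convex_Times intro!: convex_Times) fastforce
  have S: "convex (?q ` V)" by (rule convex_hermitian_image[OF q]) simp
  obtain l :: "real \<times> real \<times> real" and c where l: "l \<noteq> 0" "\<And>t. t \<in> T \<Longrightarrow> inner l t \<le> c"
    "\<And>z. z \<in> V \<Longrightarrow> c \<le> inner l (?q z)"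
    using separating_hyperplane_sets[OF T(1) S T(2) _ T(3)] slater(1)
    by (metis (no_types, lifting) emptyE imageI)
  obtain a b d where abd: "l = (a, b, d)" by (cases l)
  \<comment> \<open>The image is a cone, so a functional bounded below on it is nonnegative on it: a
    negative value could be scaled to c - 1.\<close>
  have scale: "c \<le> k * inner l (?q z)" if "z \<in> V" "0 \<le> k" for z k
    using hermitian_map_on_scale[OF q that] l(3) by (metis inner_scaleR_right)
  have c: "c \<le> 0" using scale[OF slater(1), of 0] by simp
  have pos: "0 \<le> a * F z + b * g1 z + d * g2 z" if "z \<in> V" for z
  proof (rule ccontr)
    assume "\<not> ?thesis"
    then have neg: "inner l (?q z) < 0" by (simp add: abd inner_prod_def)
    then have "c \<le> (c - 1) / inner l (?q z) * inner l (?q z)"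
      using c by (intro scale[OF that]) (auto intro: divide_nonpos_nonpos)
    then show False using neg by simp
  qed
  \<comment> \<open>Since \<open>T\<close> is unbounded in every coordinate, the signs of a, b and d
    follow from this inequality. If b were positive, r = 1, s = (a + 1) / b, t = 0 would give the
    left side the value 1.\<close>
  have T_le: "- a * r + b * s + d * t \<le> 0" if "0 < r" "0 \<le> s" "0 \<le> t" for r s t
    using l(2)[of "(-r, s, t)"] that c by (auto simp: T_def abd inner_prod_def)
  have a: "0 \<le> a" using T_le[of 1 0 0] by simp
  have b: "b \<le> 0"
  proof (rule ccontr)
    assume "\<not> ?thesis"
    then show False using T_le[of 1 "(a + 1) / b" 0] a by simp
  qed
  have d: "d \<le> 0"
  proof (rule ccontr)
    assume "\<not> ?thesis"
    then show False using T_le[of 1 0 "(a + 1) / d"] a by simp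
  qed
  \<comment> \<open>If a were 0, the Slater point would force b = d = 0 as well, against
    \<open>l \<noteq> 0\<close>.\<close>
  have "a \<noteq> 0"
  proof
    assume "a = 0"
    then have "0 \<le> b * g1 z0 + d * g2 z0" using pos[OF slater(1)] by simp
    moreover have "b * g1 z0 \<le> 0" "d * g2 z0 \<le> 0"
      using b d slater by (auto intro: mult_nonpos_nonneg)
    ultimately have "b * g1 z0 = 0" "d * g2 z0 = 0" by linarith+
    then show False using slater l(1) \<open>a = 0\<close> by (simp add: abd zero_prod_def)
  qed
  with a have a: "0 < a" by simp
  show ?thesis
  proof (rule that[of "- b / a" "- d / a"])
    fix z assume "z \<in> V"
    then show "- b / a * g1 z + - d / a * g2 z \<le> F z"
      using pos[of z] a by (simp add: field_simps)
  qed (use a b d in \<open>auto simp: divide_nonpos_pos\<close>)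
qed

section \<open>Hermitian products, adjoints and the pseudo-inverse\<close>

lemma vherm_add_left:
  assumes "dim_vec u = dim_vec v"
  shows "vherm (u + v) w = vherm u w + vherm v w"
  using assms by (simp add: vherm_def sum.distrib distrib_right)

lemma vherm_add_right:
  assumes "dim_vec w = dim_vec u"
  shows "vherm u (v + w) = vherm u v + vherm u w"
  using assms by (simp add: vherm_def sum.distrib distrib_left)

lemma vherm_smult_left: "vherm (c \<cdot>\<^sub>v u) v = cnj c * vherm u v"
  by (simp add: vherm_def sum_distrib_left mult.assoc)

lemma vherm_smult_right:
  assumes "dim_vec v = dim_vec u"
  shows "vherm u (c \<cdot>\<^sub>v v) = c * vherm u v"
  using assms by (simp add: vherm_def sum_distrib_left mult.left_commute)

lemma vherm_uminus_right:
  assumes "dim_vec v = dim_vec u"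
  shows "vherm u (- v) = - vherm u v"
  using assms by (simp add: vherm_def sum_negf)

lemma vherm_commute:
  assumes "dim_vec v = dim_vec u"
  shows "vherm v u = cnj (vherm u v)"
  using assms by (simp add: vherm_def mult.commute)

lemma vherm_self: "vherm v v = of_real ((vnorm v)\<^sup>2)"
proof -
  have "0 \<le> (\<Sum>i<dim_vec v. (cmod (v $ i))\<^sup>2)" by (rule sum_nonneg) simp
  then show ?thesis
    by (simp add: vherm_def vnorm_def mult.commute[of "cnj _"] complex_norm_square[symmetric])
qed

lemma vnorm_sq: "(vnorm v)\<^sup>2 = (\<Sum>i<dim_vec v. (cmod (v $ i))\<^sup>2)"
  by (simp add: vnorm_def sum_nonneg)

lemma vnorm_nonneg: "0 \<le> vnorm v"
  by (simp add: vnorm_def sum_nonneg)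

lemma vnorm_smult: "vnorm (c \<cdot>\<^sub>v v) = cmod c * vnorm v"
  by (simp add: vnorm_def norm_mult power_mult_distrib sum_distrib_left[symmetric] real_sqrt_mult)

lemma vnorm_zero [simp]: "vnorm (0\<^sub>v k) = 0"
  by (simp add: vnorm_def)

lemma vnorm_eq_0:
  assumes "v \<in> carrier_vec k" "vnorm v = 0"
  shows "v = 0\<^sub>v k"
proof -
  have "(\<Sum>i<k. (cmod (v $ i))\<^sup>2) = 0" using vnorm_sq[of v] assms by simp
  then have "\<forall>i<k. v $ i = 0" by (subst (asm) sum_nonneg_eq_0_iff) auto
  then show ?thesis using assms by (intro eq_vecI) auto
qed

lemma component_le_vnorm:
  assumes "i < dim_vec v"
  shows "cmod (v $ i) \<le> vnorm v"
proof (rule power2_le_imp_le)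
  show "(cmod (v $ i))\<^sup>2 \<le> (vnorm v)\<^sup>2"
    unfolding vnorm_sq using assms by (intro member_le_sum) auto
qed (rule vnorm_nonneg)

lemma vnorm_sq_add:
  assumes "dim_vec v = dim_vec u"
  shows "(vnorm (u + v))\<^sup>2 = (vnorm u)\<^sup>2 + (vnorm v)\<^sup>2 + 2 * Re (vherm u v)"
proof -
  have "vherm (u + v) (u + v) = vherm u u + vherm v v + vherm u v + vherm v u"
    using assms by (simp add: vherm_add_left vherm_add_right)
  then have "of_real ((vnorm (u + v))\<^sup>2) = vherm u u + vherm v v + vherm u v + vherm v u"
    by (simp only: vherm_self)
  then have "(vnorm (u + v))\<^sup>2 = Re (vherm u u + vherm v v + vherm u v + vherm v u)"
    by (metis Re_complex_of_real)
  then show ?thesis using vherm_commute[OF assms] by (simp add: vherm_self)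
qed

lemma vherm_append:
  assumes "dim_vec v1 = dim_vec u1" "dim_vec v2 = dim_vec u2"
  shows "vherm (u1 @\<^sub>v u2) (v1 @\<^sub>v v2) = vherm u1 v1 + vherm u2 v2"
proof -
  have conj: "vherm u v = conjugate u \<bullet> v" if "dim_vec u = dim_vec v" for u v
    using that by (simp add: vherm_def scalar_prod_def lessThan_atLeast0)
  have "conjugate (u1 @\<^sub>v u2) = conjugate u1 @\<^sub>v conjugate u2"
    by (intro eq_vecI) auto
  moreover have "(conjugate u1 @\<^sub>v conjugate u2) \<bullet> (v1 @\<^sub>v v2) = conjugate u1 \<bullet> v1 + conjugate u2 \<bullet> v2"
    by (rule scalar_prod_append[of _ "dim_vec u1" _ "dim_vec u2"])
      (rule carrier_vecI, simp add: assms)+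
  ultimately show ?thesis
    by (simp only: conj assms index_append_vec(2))
qed

section \<open>Adjoints of matrices\<close>

lemma dim_mat_adjoint [simp]:
  "dim_row (mat_adjoint A) = dim_col A" "dim_col (mat_adjoint A) = dim_row A"
  by (simp_all add: mat_adjoint_def)

lemma mat_adjoint_carrier: "A \<in> carrier_mat k l \<Longrightarrow> mat_adjoint A \<in> carrier_mat l k"
  by (metis carrier_matD carrier_matI dim_mat_adjoint)

lemma index_mat_adjoint [simp]:
  assumes "i < dim_col A" "j < dim_row A"
  shows "mat_adjoint A $$ (i, j) = conjugate (A $$ (j, i))"
  using assms by (simp add: mat_adjoint_def mat_of_rows_index)

lemma mat_adjoint_adjoint [simp]: "mat_adjoint (mat_adjoint A) = (A :: complex mat)"
  by (intro eq_matI) auto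

lemma mat_adjoint_mult:
  assumes "A \<in> carrier_mat k l" "B \<in> carrier_mat l r"
  shows "mat_adjoint (A * B) = mat_adjoint B * mat_adjoint (A :: complex mat)"
  using assms by (intro eq_matI) (auto simp: scalar_prod_def mult.commute intro!: sum.cong)

lemma mat_adjoint_minus:
  assumes "A \<in> carrier_mat k l" "B \<in> carrier_mat k l"
  shows "mat_adjoint (A - B) = mat_adjoint A - mat_adjoint (B :: complex mat)"
  using assms by (intro eq_matI) auto

lemma mat_adjoint_one [simp]: "mat_adjoint (1\<^sub>m k) = (1\<^sub>m k :: complex mat)"
  by (intro eq_matI) auto

lemma mat_adjoint_zero [simp]: "mat_adjoint (0\<^sub>m k l) = (0\<^sub>m l k :: complex mat)"
  by (intro eq_matI) auto

lemma mat_adjoint_smult [simp]: "mat_adjoint (c \<cdot>\<^sub>m A) = cnj c \<cdot>\<^sub>m mat_adjoint A"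
  by (intro eq_matI) auto

lemma mat_adjoint_uminus [simp]: "mat_adjoint (- A) = - mat_adjoint (A :: complex mat)"
  by (intro eq_matI) auto

lemma mat_adjoint_rowH [simp]: "mat_adjoint (rowH v) = colm v"
  by (intro eq_matI) (auto simp: rowH_def colm_def)

lemma mat_adjoint_colm [simp]: "mat_adjoint (colm v) = rowH v"
  by (intro eq_matI) (auto simp: rowH_def colm_def)

lemma mat_adjoint_four_block:
  assumes "A \<in> carrier_mat k l" "B \<in> carrier_mat k l'" "C \<in> carrier_mat k' l" "D \<in> carrier_mat k' l'"
  shows "mat_adjoint (four_block_mat A B C D) =
    four_block_mat (mat_adjoint A) (mat_adjoint C) (mat_adjoint B) (mat_adjoint (D :: complex mat))"
  using assms by (intro eq_matI) auto

lemma vherm_mat_adjoint: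
  assumes "A \<in> carrier_mat k l" "u \<in> carrier_vec k" "v \<in> carrier_vec l"
  shows "vherm u (A *\<^sub>v v) = vherm (mat_adjoint A *\<^sub>v u) v"
proof -
  have "vherm u (A *\<^sub>v v) = (\<Sum>i<k. \<Sum>j<l. cnj (u $ i) * (A $$ (i, j) * v $ j))"
    using assms by (simp add: vherm_def scalar_prod_def sum_distrib_left lessThan_atLeast0)
  also have "\<dots> = (\<Sum>j<l. \<Sum>i<k. cnj (u $ i) * (A $$ (i, j) * v $ j))"
    by (rule sum.swap)
  also have "\<dots> = vherm (mat_adjoint A *\<^sub>v u) v"
    using assms by (simp add: vherm_def scalar_prod_def sum_distrib_right lessThan_atLeast0 sum_distrib_left mult_ac)
  finally show ?thesis .
qed

section \<open>Full column rank and the pseudo-inverse\<close>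

lemma full_column_rank_kernel:
  fixes H :: "complex mat"
  assumes H: "H \<in> carrier_mat m n" and rank: "vec_space.rank m H = n"
    and v: "v \<in> carrier_vec n" "H *\<^sub>v v = 0\<^sub>v m"
  shows "v = 0\<^sub>v n"
proof (rule ccontr)
  assume "v \<noteq> 0\<^sub>v n"
  interpret vec_space "TYPE(complex)" m .
  \<comment> \<open>The rank facts used below speak of the set of columns, so repetitions are
    excluded first: they would leave fewer than n vectors from which to choose an independent
    set.\<close>
  have "distinct (cols H)"
  proof (rule ccontr)
    assume ndist: "\<not> distinct (cols H)"
    obtain S where S: "maximal S (\<lambda>T. T \<subseteq> set (cols H) \<and> lin_indpt T)"
      using maximal_exists[of "(\<lambda>T. T \<subseteq> set (cols H) \<and> lin_indpt T)" "card (set (cols H))" "{}"]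
      by (meson List.finite_set card_mono empty_iff empty_subsetI finite_lin_indpt2 rev_finite_subset)
    then have "card S \<le> card (set (cols H))" by (simp add: card_mono maximal_def)
    moreover have "card (set (cols H)) < n"
      using ndist H card_length[of "cols H"] card_distinct[of "cols H"]
      by (metis carrier_matD(2) cols_length nat_less_le)
    ultimately show False using rank_card_indpt[OF H S] rank by simp
  qed
  then show False
    using lin_depI[OF H v(1) \<open>v \<noteq> 0\<^sub>v n\<close> v(2)] full_rank_lin_indpt[OF H rank] by blast
qed

text \<open>If H^H H v = 0 then |Hv|^2 = v^H H^H H v = 0, so full column rank gives v = 0 and the
  Gram matrix is invertible. Its inverse is Hermitian by uniqueness of inverses.\<close>

lemma gram_inverse:
  fixes H :: "complex mat"
  assumes H: "H \<in> carrier_mat m n" and rank: "vec_space.rank m H = n"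
  obtains B where "B \<in> carrier_mat n n" "B * (mat_adjoint H * H) = 1\<^sub>m n" "mat_adjoint B = B"
proof -
  let ?A = "mat_adjoint H * H"
  have H': "mat_adjoint H \<in> carrier_mat n m" using H by (rule mat_adjoint_carrier)
  have A: "?A \<in> carrier_mat n n" using H H' by simp
  have adjA: "mat_adjoint ?A = ?A" using mat_adjoint_mult[OF H' H] by simp
  have "det ?A \<noteq> 0"
  proof
    assume "det ?A = 0"
    then obtain v where v: "v \<in> carrier_vec n" "v \<noteq> 0\<^sub>v n" "?A *\<^sub>v v = 0\<^sub>v n"
      using det_0_iff_vec_prod_zero_field[OF A] by blast
    have Hv: "H *\<^sub>v v \<in> carrier_vec m" using H v by simp
    have "vherm (H *\<^sub>v v) (H *\<^sub>v v) = vherm (?A *\<^sub>v v) v"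
      using vherm_mat_adjoint[OF H Hv v(1)] assoc_mult_mat_vec[OF H' H v(1)] by simp
    then have "vnorm (H *\<^sub>v v) = 0"
      using v by (simp add: vherm_self) (simp add: vherm_def)
    then show False
      using vnorm_eq_0[OF Hv] full_column_rank_kernel[OF H rank v(1)] v(2) by simp
  qed
  then obtain B where B: "B \<in> carrier_mat n n" "B * ?A = 1\<^sub>m n" "?A * B = 1\<^sub>m n"
    using det_non_zero_imp_unit[OF A, of undefined] by (auto simp: Units_def ring_mat_def)
  have B': "mat_adjoint B \<in> carrier_mat n n" using B(1) by (rule mat_adjoint_carrier)
  have "mat_adjoint B * ?A = 1\<^sub>m n"
    using mat_adjoint_mult[OF A B(1)] B(3) adjA by simp
  then have "mat_adjoint B = B"
    using assoc_mult_mat[OF B' A B(1)] B B' by simp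
  then show ?thesis using that B by blast
qed

text \<open>\<open>mp_pinv\<close> is a definite description, so a witness and its uniqueness are
  required. The witness is L = (H^H H)^(-1) H^H.\<close>

lemma mp_pinv_full_column_rank:
  fixes H :: "complex mat"
  assumes H: "H \<in> carrier_mat m n" and rank: "vec_space.rank m H = n"
  shows "mp_pinv H \<in> carrier_mat n m" "mp_pinv H * H = 1\<^sub>m n"
    "mat_adjoint (H * mp_pinv H) = H * mp_pinv H"
proof -
  obtain B where B: "B \<in> carrier_mat n n" "B * (mat_adjoint H * H) = 1\<^sub>m n" "mat_adjoint B = B"
    using gram_inverse[OF assms] .
  have H': "mat_adjoint H \<in> carrier_mat n m" using H by (rule mat_adjoint_carrier)
  define L where "L = B * mat_adjoint H"
  have L: "L \<in> carrier_mat n m" using B H' by (simp add: L_def)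
  have LH: "L * H = 1\<^sub>m n"
    using assoc_mult_mat[OF B(1) H' H] B(2) by (simp add: L_def)
  define P where "P = (\<lambda>X. X \<in> carrier_mat (dim_col H) (dim_row H) \<and>
      H * X * H = H \<and> X * H * X = X \<and>
      mat_adjoint (H * X) = H * X \<and> mat_adjoint (X * H) = X * H)"
  have "mat_adjoint L = H * B"
    using mat_adjoint_mult[OF B(1) H'] B(3) by (simp add: L_def)
  then have "mat_adjoint (H * L) = H * L"
    using mat_adjoint_mult[OF H L] assoc_mult_mat[OF H B(1) H'] by (simp add: L_def)
  moreover have "H * L * H = H" using assoc_mult_mat[OF H L H] LH H by simp
  ultimately have PL: "P L" using L H LH by (simp add: P_def)
  have unique: "X = L" if "P X" for X
  proof -
    have X: "X \<in> carrier_mat n m" "H * X * H = H" "mat_adjoint (H * X) = H * X"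
      using that H by (auto simp: P_def)
    have HX: "H * X \<in> carrier_mat m m" and HL: "H * L \<in> carrier_mat m m" using H X L by auto
    have XH: "X * H = 1\<^sub>m n"
    proof -
      have "X * H = (L * H) * (X * H)" using LH X H by simp
      also have "\<dots> = L * (H * X * H)"
        using assoc_mult_mat[OF L H, of "X * H" n] assoc_mult_mat[OF H X(1) H] X(1) H by simp
      finally show ?thesis using X(2) LH by simp
    qed
    \<comment> \<open>H L and H X are Hermitian and both fix the columns of H, so each absorbs the
      other from the left. Taking adjoints shows that they agree, and the left inverse L then
      cancels H.\<close>
    have "(H * L) * (H * X) = H * X"
      using assoc_mult_mat[OF HL H X(1)] \<open>H * L * H = H\<close> by simp
    moreover have "(H * X) * (H * L) = H * L"
      using assoc_mult_mat[OF HX H L] X(2) by simp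
    moreover have "mat_adjoint ((H * L) * (H * X)) = (H * X) * (H * L)"
      using mat_adjoint_mult[OF HL HX] X(3) \<open>mat_adjoint (H * L) = H * L\<close> by simp
    ultimately have eq: "H * X = H * L" using X(3) by simp
    have "X = L * (H * X)" using assoc_mult_mat[OF L H X(1)] LH X(1) by simp
    also have "\<dots> = L" unfolding eq using assoc_mult_mat[OF L H L] LH L by simp
    finally show ?thesis .
  qed
  have "mp_pinv H = L"
    unfolding mp_pinv_def P_def[symmetric] using PL unique by (intro the_equality)
  then show "mp_pinv H \<in> carrier_mat n m" "mp_pinv H * H = 1\<^sub>m n"
    "mat_adjoint (H * mp_pinv H) = H * mp_pinv H"
    using L LH PL by (auto simp: P_def)
qed

text \<open>\<open>projP H\<close> is Hermitian because H H^+ is. Realness of \<open>kappa\<close>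
  makes the corner entry of the block matrix real, as its Hermitian symmetry demands.\<close>

lemma kappa_real:
  assumes H: "H \<in> carrier_mat m n" and rank: "vec_space.rank m H = n" and y: "y \<in> carrier_vec m"
  shows "cnj (kappa H y) = kappa H y"
proof -
  have HX: "H * mp_pinv H \<in> carrier_mat m m" 
    using mp_pinv_full_column_rank(1)[OF H rank] H by simp
  have "projP H = 1\<^sub>m m - H * mp_pinv H" using H by (simp add: projP_def)
  then have P: "projP H \<in> carrier_mat m m" "mat_adjoint (projP H) = projP H"
    using minus_carrier_mat[OF HX] mat_adjoint_minus[OF one_carrier_mat HX] mp_pinv_full_column_rank(3)[OF H rank]
    by simp_all
  have "cnj (vherm (projP H *\<^sub>v y) y) = vherm y (projP H *\<^sub>v y)"
    using P(1) y by (intro vherm_commute[symmetric]) simp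
  also have "vherm y (projP H *\<^sub>v y) = vherm (projP H *\<^sub>v y) y"
    using vherm_mat_adjoint[OF P(1) y y] P(2) by simp
  finally show ?thesis unfolding kappa_def using vherm_mat_adjoint[OF P(1) y y] P(2) by simp
qed

lemma hermitian_map_on_forms:
  assumes carr: "A \<in> carrier_mat k k" "B \<in> carrier_mat k k" "C \<in> carrier_mat k k"
  shows "hermitian_map_on (carrier_vec k)
    (\<lambda>z. (Re (vherm z (A *\<^sub>v z)), Re (vherm z (B *\<^sub>v z)), Re (vherm z (C *\<^sub>v z))))"
  unfolding hermitian_map_on_def
proof (intro ballI)
  fix x y :: "complex vec" assume xy: "x \<in> carrier_vec k" "y \<in> carrier_vec k"
  \<comment> \<open>Under the real part the second mixed term may be conjugated, which collects both
    in one real-linear function of conj(u) v.\<close>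
  define cross where "cross = (\<lambda>M. vherm x (M *\<^sub>v y) + cnj (vherm y (M *\<^sub>v x)))"
  have form: "Re (vherm (u \<cdot>\<^sub>v x + v \<cdot>\<^sub>v y) (M *\<^sub>v (u \<cdot>\<^sub>v x + v \<cdot>\<^sub>v y))) =
      (cmod u)\<^sup>2 * Re (vherm x (M *\<^sub>v x)) + (cmod v)\<^sup>2 * Re (vherm y (M *\<^sub>v y)) + Re (cnj u * v * cross M)"
    if M: "M \<in> carrier_mat k k" for M u v
  proof -
    have "M *\<^sub>v (u \<cdot>\<^sub>v x + v \<cdot>\<^sub>v y) = u \<cdot>\<^sub>v (M *\<^sub>v x) + v \<cdot>\<^sub>v (M *\<^sub>v y)"
      using M xy by (simp add: mult_add_distrib_mat_vec[of _ k k] mult_mat_vec[of _ k k])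
    then have "vherm (u \<cdot>\<^sub>v x + v \<cdot>\<^sub>v y) (M *\<^sub>v (u \<cdot>\<^sub>v x + v \<cdot>\<^sub>v y)) =
        cnj u * u * vherm x (M *\<^sub>v x) + cnj v * v * vherm y (M *\<^sub>v y)
        + (cnj u * v * vherm x (M *\<^sub>v y) + cnj v * u * vherm y (M *\<^sub>v x))"
      using M xy by (simp add: vherm_add_left vherm_add_right vherm_smult_left vherm_smult_right algebra_simps)
    then show ?thesis
      unfolding cross_def cmod_power2 by (simp add: power2_eq_square algebra_simps)
  qed
  define h where "h = (\<lambda>w. (Re (w * cross A), Re (w * cross B), Re (w * cross C)))"
  have "linear h"
    unfolding h_def by (rule linearI) (simp_all add: algebra_simps)
  moreover have "\<exists>z\<in>carrier_vec k.
      (Re (vherm z (A *\<^sub>v z)), Re (vherm z (B *\<^sub>v z)), Re (vherm z (C *\<^sub>v z))) =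
      (cmod u)\<^sup>2 *\<^sub>R (Re (vherm x (A *\<^sub>v x)), Re (vherm x (B *\<^sub>v x)), Re (vherm x (C *\<^sub>v x)))
      + (cmod v)\<^sup>2 *\<^sub>R (Re (vherm y (A *\<^sub>v y)), Re (vherm y (B *\<^sub>v y)), Re (vherm y (C *\<^sub>v y)))
      + h (cnj u * v)" for u v
  proof (rule bexI)
    show "u \<cdot>\<^sub>v x + v \<cdot>\<^sub>v y \<in> carrier_vec k" using xy by simp
  qed (simp only: form[OF carr(1)] form[OF carr(2)] form[OF carr(3)] h_def scaleR_Pair add_Pair real_scaleR_def)
  ultimately show "\<exists>h. linear h \<and> (\<forall>u v. \<exists>z\<in>carrier_vec k.
      (Re (vherm z (A *\<^sub>v z)), Re (vherm z (B *\<^sub>v z)), Re (vherm z (C *\<^sub>v z))) =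
      (cmod u)\<^sup>2 *\<^sub>R (Re (vherm x (A *\<^sub>v x)), Re (vherm x (B *\<^sub>v x)), Re (vherm x (C *\<^sub>v x)))
      + (cmod v)\<^sup>2 *\<^sub>R (Re (vherm y (A *\<^sub>v y)), Re (vherm y (B *\<^sub>v y)), Re (vherm y (C *\<^sub>v y)))
      + h (cnj u * v))"
    by blast
qed

section \<open>Vectors and matrices with a scalar block\<close>

abbreviation vec1 :: "complex \<Rightarrow> complex vec" where
  "vec1 t \<equiv> vec 1 (\<lambda>_. t)"

lemma vec1_add: "vec1 s + vec1 t = vec1 (s + t)"
  by (intro eq_vecI) auto

lemma smult_vec1: "c \<cdot>\<^sub>v vec1 t = vec1 (c * t)"
  by (intro eq_vecI) auto

lemma vec1_cases:
  assumes "v \<in> carrier_vec 1"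
  obtains t where "v = vec1 t"
proof -
  have "v = vec1 (v $ 0)" using assms by (intro eq_vecI) auto
  then show ?thesis by (rule that)
qed

lemma vherm_vec1: "vherm (vec1 s) (vec1 t) = cnj s * t"
  by (simp add: vherm_def)

lemma mat11_mult_vec1: "mat 1 1 (\<lambda>_. c) *\<^sub>v vec1 t = vec1 (c * t)"
  by (intro eq_vecI) (auto simp: scalar_prod_def)

lemma rowH_mult_vec:
  assumes "dim_vec u = dim_vec r"
  shows "rowH r *\<^sub>v u = vec1 (vherm r u)"
  using assms by (intro eq_vecI) (auto simp: rowH_def vherm_def scalar_prod_def lessThan_atLeast0)

lemma colm_mult_vec1: "colm r *\<^sub>v vec1 t = t \<cdot>\<^sub>v r"
  by (intro eq_vecI) (auto simp: colm_def scalar_prod_def mult.commute)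

lemma smult_mat_mult_vec:
  assumes "dim_vec v = dim_col A"
  shows "(c \<cdot>\<^sub>m A) *\<^sub>v v = c \<cdot>\<^sub>v (A *\<^sub>v v)"
  using assms by (intro eq_vecI) (auto simp: scalar_prod_def sum_distrib_left mult.assoc)

lemma zero_mat_mult_vec:
  assumes "dim_vec v = l"
  shows "0\<^sub>m k l *\<^sub>v v = 0\<^sub>v k"
  using assms by (intro eq_vecI) (auto simp: scalar_prod_def)

lemma rowH_carrier [simp]: "v \<in> carrier_vec k \<Longrightarrow> rowH v \<in> carrier_mat 1 k"
  by (auto simp: rowH_def)

lemma colm_carrier [simp]: "v \<in> carrier_vec k \<Longrightarrow> colm v \<in> carrier_mat k 1"
  by (auto simp: colm_def)

text \<open>The simplifier rewrites the dimension 1 to \<open>Suc 0\<close>, so the carrier facts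
  are registered in that form too.\<close>

declare rowH_carrier[unfolded One_nat_def, simp] colm_carrier[unfolded One_nat_def, simp]

text \<open>Homogenisation: a bound relative to t becomes a bound on the unit ball. At t = 0 the
  vector vanishes and a' = 0 serves, which also covers perturbation radii equal to 0.\<close>

lemma vnorm_le_cmodE:
  assumes "a \<in> carrier_vec k" "vnorm a \<le> cmod t"
  obtains a' where "a' \<in> carrier_vec k" "a = t \<cdot>\<^sub>v a'" "vnorm a' \<le> 1"
proof (cases "t = 0")
  case True
  then have "vnorm a = 0" using assms(2) vnorm_nonneg[of a] by simp
  then have "a = 0\<^sub>v k" using assms(1) by (intro vnorm_eq_0)
  then have "a = t \<cdot>\<^sub>v 0\<^sub>v k" by (intro eq_vecI) auto
  then show ?thesis by (rule that[rotated]) auto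
next
  case False
  show ?thesis
  proof (rule that[of "(1 / t) \<cdot>\<^sub>v a"])
    show "a = t \<cdot>\<^sub>v ((1 / t) \<cdot>\<^sub>v a)" using False assms(1) by (intro eq_vecI) auto
    show "vnorm ((1 / t) \<cdot>\<^sub>v a) \<le> 1"
      using False assms(2) by (simp add: vnorm_smult norm_divide)
    show "(1 / t) \<cdot>\<^sub>v a \<in> carrier_vec k" using assms(1) by simp
  qed
qed

section \<open>Norm estimates and compactness\<close>

lemma vnorm_uminus [simp]: "vnorm (- v) = vnorm v"
  by (simp add: vnorm_def)

lemma vnorm_sq_add_le:
  assumes "dim_vec u = dim_vec v"
  shows "(vnorm (u + v))\<^sup>2 \<le> 2 * (vnorm u)\<^sup>2 + 2 * (vnorm v)\<^sup>2"
proof -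
  have "(cmod (a + b))\<^sup>2 \<le> 2 * (cmod a)\<^sup>2 + 2 * (cmod b)\<^sup>2" for a b :: complex
  proof -
    have "(cmod (a + b))\<^sup>2 \<le> (cmod a + cmod b)\<^sup>2"
      by (intro power_mono norm_triangle_ineq) simp
    also have "\<dots> \<le> 2 * (cmod a)\<^sup>2 + 2 * (cmod b)\<^sup>2"
      using zero_le_power2[of "cmod a - cmod b"] by (simp add: power2_diff power2_sum)
    finally show ?thesis .
  qed
  then have "(\<Sum>i<dim_vec v. (cmod (u $ i + v $ i))\<^sup>2) \<le> (\<Sum>i<dim_vec v. 2 * (cmod (u $ i))\<^sup>2 + 2 * (cmod (v $ i))\<^sup>2)"
    by (intro sum_mono)
  then show ?thesis
    using assms by (simp add: vnorm_sq sum.distrib sum_distrib_left)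
qed

lemma vnorm_mult_mat_vec_bound:
  assumes A: "A \<in> carrier_mat k l"
  obtains K where "0 \<le> K" "\<And>v. v \<in> carrier_vec l \<Longrightarrow> vnorm (A *\<^sub>v v) \<le> K * vnorm v"
proof -
  \<comment> \<open>Absolute row sums. Every component of v is at most \<open>vnorm v\<close>, so
    the Euclidean norm of the row sums is an admissible constant.\<close>
  define R where "R = (\<lambda>j. \<Sum>i<l. cmod (A $$ (j, i)))"
  show ?thesis
  proof (rule that)
    show "0 \<le> sqrt (\<Sum>j<k. (R j)\<^sup>2)" by (simp add: sum_nonneg)
    fix v :: "complex vec" assume v: "v \<in> carrier_vec l"
    have "cmod ((A *\<^sub>v v) $ j) \<le> R j * vnorm v" if "j < k" for j
    proof -
      have "cmod ((A *\<^sub>v v) $ j) = cmod (\<Sum>i<l. A $$ (j, i) * v $ i)"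
        using that A v by (simp add: scalar_prod_def lessThan_atLeast0)
      also have "\<dots> \<le> (\<Sum>i<l. cmod (A $$ (j, i)) * vnorm v)"
        using v by (intro sum_norm_le) (auto simp: norm_mult intro!: mult_left_mono component_le_vnorm)
      finally show ?thesis by (simp add: R_def sum_distrib_right)
    qed
    then have "(\<Sum>j<k. (cmod ((A *\<^sub>v v) $ j))\<^sup>2) \<le> (\<Sum>j<k. (R j * vnorm v)\<^sup>2)"
      by (intro sum_mono power_mono) auto
    also have "\<dots> = (sqrt (\<Sum>j<k. (R j)\<^sup>2) * vnorm v)\<^sup>2"
      by (simp add: power_mult_distrib sum_distrib_right sum_nonneg)
    finally have "(vnorm (A *\<^sub>v v))\<^sup>2 \<le> (sqrt (\<Sum>j<k. (R j)\<^sup>2) * vnorm v)\<^sup>2"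
      using A by (simp add: vnorm_sq)
    then show "vnorm (A *\<^sub>v v) \<le> sqrt (\<Sum>j<k. (R j)\<^sup>2) * vnorm v"
      by (rule power2_le_imp_le) (intro mult_nonneg_nonneg vnorm_nonneg real_sqrt_ge_zero sum_nonneg zero_le_power2)
  qed
qed

lemma vherm_bound:
  assumes d: "d \<in> carrier_vec k"
  obtains K where "0 \<le> K" "\<And>v. v \<in> carrier_vec k \<Longrightarrow> cmod (vherm d v) \<le> K * vnorm v"
proof -
  obtain K where K: "0 \<le> K" "\<And>v. v \<in> carrier_vec k \<Longrightarrow> vnorm (rowH d *\<^sub>v v) \<le> K * vnorm v"
    using vnorm_mult_mat_vec_bound[OF rowH_carrier[OF d]] by blast
  have "vnorm (rowH d *\<^sub>v v) = cmod (vherm d v)" if "v \<in> carrier_vec k" for v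
    using that d by (subst rowH_mult_vec) (auto simp: vnorm_def)
  with K show ?thesis using that by simp
qed

text \<open>Bolzano-Weierstrass where the dimension is a number and not a type: vectors are replaced
  by their coordinate functions, and the subsequence is extracted over the finite set of
  coordinates.\<close>

lemma bounded_vec_seq_convergent_subseq:
  fixes X :: "nat \<Rightarrow> complex vec"
  assumes X: "\<And>k. X k \<in> carrier_vec n" and bound: "\<And>k. vnorm (X k) \<le> B"
  obtains x r where "x \<in> carrier_vec n" "strict_mono r"
    "\<forall>i<n. (\<lambda>k. X (r k) $ i) \<longlonglongrightarrow> x $ i"
proof -
  have "bounded ((\<lambda>f. f i) ` range (\<lambda>k i. X k $ i))" if "i \<in> {..<n}" for i
  proof (rule boundedI)
    fix c assume "c \<in> (\<lambda>f. f i) ` range (\<lambda>k i. X k $ i)"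
    then obtain k where "c = X k $ i" by auto
    then show "norm c \<le> B"
      using component_le_vnorm[of i "X k"] bound[of k] that X[of k] by auto
  qed
  then have "\<forall>D\<subseteq>{..<n}. \<exists>l r. strict_mono r \<and>
      (\<forall>e>0. \<forall>\<^sub>F k in sequentially. \<forall>i\<in>D. dist (X (r k) $ i) (l i) < e)"
    by (intro compact_lemma_general[where unproj = "\<lambda>f. f" and proj = "\<lambda>f. f" and f = "\<lambda>k i. X k $ i"]) auto
  then obtain l r where r: "strict_mono r"
    and l: "\<And>e. e > 0 \<Longrightarrow> \<forall>\<^sub>F k in sequentially. \<forall>i\<in>{..<n}. dist (X (r k) $ i) (l i) < e"
    by blast
  have "(\<lambda>k. X (r k) $ i) \<longlonglongrightarrow> vec n l $ i" if "i < n" for i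
  proof (rule tendstoI)
    fix e :: real assume "e > 0"
    from l[OF this] show "\<forall>\<^sub>F k in sequentially. dist (X (r k) $ i) (vec n l $ i) < e"
      by (rule eventually_mono) (use that in auto)
  qed
  then show ?thesis using r that[of "vec n l" r] by auto
qed

section \<open>The quadratic form of the block matrix\<close>

locale regret_data =
  fixes m n p :: nat and H :: "complex mat" and Hs :: "nat \<Rightarrow> complex mat"
    and y :: "complex vec" and ys :: "nat \<Rightarrow> complex vec"
  assumes H: "H \<in> carrier_mat m n" and Hs: "\<And>i. i < p \<Longrightarrow> Hs i \<in> carrier_mat m n"
    and rank: "vec_space.rank m H = n"
    and y: "y \<in> carrier_vec m" and ys: "\<And>i. i < p \<Longrightarrow> ys i \<in> carrier_vec m"
begin

abbreviation "d \<equiv> dvec H Hs y p"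
abbreviation "b \<equiv> bvec H ys y p"
abbreviation "G x \<equiv> Gmat Hs x m p"
abbreviation "Q \<equiv> Qmat ys m p"
abbreviation "res x \<equiv> y - H *\<^sub>v x"

lemma dims [simp]:
  "dim_vec d = p" "dim_vec b = p" "dim_row (G x) = m" "dim_col (G x) = p"
  "dim_row Q = m" "dim_col Q = p" "dim_vec (res x) = m" "dim_vec y = m" "dim_row H = m" "dim_col H = n"
  using H y by (auto simp: dvec_def bvec_def Gmat_def Qmat_def)

lemma carriers [simp]:
  "d \<in> carrier_vec p" "b \<in> carrier_vec p" "G x \<in> carrier_mat m p" "Q \<in> carrier_mat m p"
  "res x \<in> carrier_vec m"
  by (intro carrier_vecI carrier_matI dims)+

lemma Im_kappa: "Im (kappa H y) = 0"
  using kappa_real[OF H rank y] by (metis Reals_cnj_iff complex_is_Real_iff)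

text \<open>The scalars are free complex parameters in the block identities;
  \<open>LMI_blocks\<close> substitutes the actual ones.\<close>

context
  fixes x :: "complex vec" and c11 da db t1 t2 :: complex
begin

abbreviation "A11 \<equiv> four_block_mat (mat 1 1 (\<lambda>_. c11)) (rowH (res x)) (colm (res x)) (1\<^sub>m m)"
abbreviation "A12 \<equiv> four_block_mat (da \<cdot>\<^sub>m rowH d) (db \<cdot>\<^sub>m rowH b) (- (da \<cdot>\<^sub>m G x)) (db \<cdot>\<^sub>m Q)"
abbreviation "A21 \<equiv> four_block_mat (da \<cdot>\<^sub>m colm d) (- (da \<cdot>\<^sub>m mat_adjoint (G x)))
  (db \<cdot>\<^sub>m colm b) (db \<cdot>\<^sub>m mat_adjoint Q)"
abbreviation "A22 \<equiv> four_block_mat (t1 \<cdot>\<^sub>m 1\<^sub>m p) (0\<^sub>m p p) (0\<^sub>m p p) (t2 \<cdot>\<^sub>m 1\<^sub>m p)"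

lemma block_carriers:
  "A11 \<in> carrier_mat (1 + m) (1 + m)" "A12 \<in> carrier_mat (1 + m) (p + p)"
  "A21 \<in> carrier_mat (p + p) (1 + m)" "A22 \<in> carrier_mat (p + p) (p + p)"
  by (rule four_block_carrier_mat; simp add: mat_adjoint_carrier)+

lemma block_adjoints:
  shows "cnj c11 = c11 \<Longrightarrow> mat_adjoint A11 = A11"
    and "cnj da = da \<Longrightarrow> cnj db = db \<Longrightarrow> mat_adjoint A12 = A21"
    and "cnj da = da \<Longrightarrow> cnj db = db \<Longrightarrow> mat_adjoint A21 = A12"
    and "cnj t1 = t1 \<Longrightarrow> cnj t2 = t2 \<Longrightarrow> mat_adjoint A22 = A22"
proof -
  show "mat_adjoint A11 = A11" if "cnj c11 = c11"
  proof -
    have "mat_adjoint (mat 1 1 (\<lambda>_. c11)) = mat 1 1 (\<lambda>_. c11)"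
      using that by (intro eq_matI) auto
    then show ?thesis
      by (subst mat_adjoint_four_block[where k = 1 and l = 1 and k' = m and l' = m]) simp_all
  qed
  show A12: "mat_adjoint A12 = A21" if "cnj da = da" "cnj db = db"
    using that by (subst mat_adjoint_four_block[where k = 1 and l = p and k' = m and l' = p]) simp_all
  show "mat_adjoint A21 = A12" if "cnj da = da" "cnj db = db"
    using A12[OF that] mat_adjoint_adjoint by metis
  show "mat_adjoint A22 = A22" if "cnj t1 = t1" "cnj t2 = t2"
    using that by (subst mat_adjoint_four_block[where k = p and l = p and k' = p and l' = p]) simp_all
qed

lemma block_mult_vec:
  assumes u: "u \<in> carrier_vec m" and a: "a \<in> carrier_vec p" and c: "c \<in> carrier_vec p"
  shows "A11 *\<^sub>v (vec1 t @\<^sub>v u) = vec1 (c11 * t + vherm (res x) u) @\<^sub>v (t \<cdot>\<^sub>v res x + u)"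
    "A12 *\<^sub>v (a @\<^sub>v c) = vec1 (da * vherm d a + db * vherm b c)
      @\<^sub>v (- (da \<cdot>\<^sub>v (G x *\<^sub>v a)) + db \<cdot>\<^sub>v (Q *\<^sub>v c))"
    "A21 *\<^sub>v (vec1 t @\<^sub>v u) = (da \<cdot>\<^sub>v (t \<cdot>\<^sub>v d) + - (da \<cdot>\<^sub>v (mat_adjoint (G x) *\<^sub>v u)))
      @\<^sub>v (db \<cdot>\<^sub>v (t \<cdot>\<^sub>v b) + db \<cdot>\<^sub>v (mat_adjoint Q *\<^sub>v u))"
    "A22 *\<^sub>v (a @\<^sub>v c) = (t1 \<cdot>\<^sub>v a) @\<^sub>v (t2 \<cdot>\<^sub>v c)"
proof -
  have dim: "dim_vec u = m" "dim_vec a = p" "dim_vec c = p"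
    "dim_col (rowH v) = dim_vec v" "dim_col (colm v) = 1" for v
    using assms by (simp_all add: rowH_def colm_def)
  have vec1: "vec1 s \<in> carrier_vec 1" for s by simp
  show "A11 *\<^sub>v (vec1 t @\<^sub>v u) = vec1 (c11 * t + vherm (res x) u) @\<^sub>v (t \<cdot>\<^sub>v res x + u)"
    by (subst four_block_mat_mult_vec[where ?nr1.0 = 1 and ?nr2.0 = m, OF _ _ _ _ vec1 u])
      (use u in \<open>simp_all only: mat_carrier rowH_carrier colm_carrier carriers one_carrier_mat
        mat11_mult_vec1 rowH_mult_vec colm_mult_vec1 vec1_add one_mult_mat_vec dim dims\<close>)
  show "A12 *\<^sub>v (a @\<^sub>v c) = vec1 (da * vherm d a + db * vherm b c)
      @\<^sub>v (- (da \<cdot>\<^sub>v (G x *\<^sub>v a)) + db \<cdot>\<^sub>v (Q *\<^sub>v c))"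
    by (subst four_block_mat_mult_vec[where ?nr1.0 = 1 and ?nr2.0 = m, OF _ _ _ _ a c])
      (simp_all only: smult_carrier_mat uminus_carrier_iff_mat rowH_carrier carriers index_smult_mat
        smult_mat_mult_vec uminus_mult_mat_vec rowH_mult_vec smult_vec1 vec1_add dim dims)
  show "A21 *\<^sub>v (vec1 t @\<^sub>v u) = (da \<cdot>\<^sub>v (t \<cdot>\<^sub>v d) + - (da \<cdot>\<^sub>v (mat_adjoint (G x) *\<^sub>v u)))
      @\<^sub>v (db \<cdot>\<^sub>v (t \<cdot>\<^sub>v b) + db \<cdot>\<^sub>v (mat_adjoint Q *\<^sub>v u))"
    by (subst four_block_mat_mult_vec[where ?nr1.0 = p and ?nr2.0 = p, OF _ _ _ _ vec1 u])
      (simp_all only: smult_carrier_mat uminus_carrier_iff_mat colm_carrier carriers mat_adjoint_carrier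
        index_smult_mat dim_mat_adjoint dim_vec
        smult_mat_mult_vec uminus_mult_mat_vec colm_mult_vec1 dim dims)
  have unit: "1\<^sub>m p *\<^sub>v a = a" "1\<^sub>m p *\<^sub>v c = c" "0\<^sub>m p p *\<^sub>v a = 0\<^sub>v p" "0\<^sub>m p p *\<^sub>v c = 0\<^sub>v p"
    using a c by (simp_all add: zero_mat_mult_vec)
  show "A22 *\<^sub>v (a @\<^sub>v c) = (t1 \<cdot>\<^sub>v a) @\<^sub>v (t2 \<cdot>\<^sub>v c)"
    by (subst four_block_mat_mult_vec[where ?nr1.0 = p and ?nr2.0 = p, OF _ _ _ _ a c])
      (use a c in \<open>simp_all add: smult_mat_mult_vec unit\<close>)
qed

end

lemma LMI_blocks:
  "LMI H Hs y ys p \<delta>a \<delta>b \<gamma> x \<tau>1 \<tau>2 = four_block_mat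
    (A11 x (complex_of_real \<gamma> + kappa H y - complex_of_real \<tau>1 - complex_of_real \<tau>2))
    (A12 x (complex_of_real \<delta>a) (complex_of_real \<delta>b))
    (A21 x (complex_of_real \<delta>a) (complex_of_real \<delta>b)) (A22 (complex_of_real \<tau>1) (complex_of_real \<tau>2))"
  by (simp add: LMI_def Let_def)

lemma LMI_carrier: "LMI H Hs y ys p \<delta>a \<delta>b \<gamma> x \<tau>1 \<tau>2 \<in> carrier_mat (1 + m + (p + p)) (1 + m + (p + p))"
  unfolding LMI_blocks by (intro four_block_carrier_mat block_carriers)

lemma LMI_hermitian: "mat_adjoint (LMI H Hs y ys p \<delta>a \<delta>b \<gamma> x \<tau>1 \<tau>2) = LMI H Hs y ys p \<delta>a \<delta>b \<gamma> x \<tau>1 \<tau>2"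
  unfolding LMI_blocks mat_adjoint_four_block[OF block_carriers]
  by (simp only: block_adjoints complex_cnj_complex_of_real complex_cnj_add complex_cnj_diff kappa_real[OF H rank y])

lemma LMI_mult_vec:
  fixes \<delta>a \<delta>b \<gamma> \<tau>1 \<tau>2 :: real
  assumes u: "u \<in> carrier_vec m" and a: "a \<in> carrier_vec p" and c: "c \<in> carrier_vec p"
  shows "LMI H Hs y ys p \<delta>a \<delta>b \<gamma> x \<tau>1 \<tau>2 *\<^sub>v ((vec1 t @\<^sub>v u) @\<^sub>v (a @\<^sub>v c)) =
    (vec1 ((\<gamma> + kappa H y - \<tau>1 - \<tau>2) * t + vherm (res x) u + (\<delta>a * vherm d a + \<delta>b * vherm b c))
      @\<^sub>v (t \<cdot>\<^sub>v res x + u + (- (\<delta>a \<cdot>\<^sub>v (G x *\<^sub>v a)) + \<delta>b \<cdot>\<^sub>v (Q *\<^sub>v c))))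
    @\<^sub>v ((\<delta>a \<cdot>\<^sub>v (t \<cdot>\<^sub>v d) + - (\<delta>a \<cdot>\<^sub>v (mat_adjoint (G x) *\<^sub>v u)) + \<tau>1 \<cdot>\<^sub>v a)
      @\<^sub>v (\<delta>b \<cdot>\<^sub>v (t \<cdot>\<^sub>v b) + \<delta>b \<cdot>\<^sub>v (mat_adjoint Q *\<^sub>v u) + \<tau>2 \<cdot>\<^sub>v c))"
proof -
  have "vec1 t @\<^sub>v u \<in> carrier_vec (1 + m)" "a @\<^sub>v c \<in> carrier_vec (p + p)"
    using assms by (intro append_carrier_vec; simp)+
  note block = four_block_mat_mult_vec[OF block_carriers this]
  have add1: "(vec1 s @\<^sub>v v) + (vec1 s' @\<^sub>v v') = vec1 (s + s') @\<^sub>v (v + v')"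
    if "dim_vec v = m" "dim_vec v' = m" for s s' v v'
    using append_vec_add[OF _ _ carrier_vecI[OF that(1)] carrier_vecI[OF that(2)], of "vec1 s" 1 "vec1 s'"]
    by (simp only: vec1_add vec_carrier)
  have add2: "(v @\<^sub>v w) + (v' @\<^sub>v w') = (v + v') @\<^sub>v (w + w')"
    if "dim_vec v = p" "dim_vec v' = p" "dim_vec w = p" "dim_vec w' = p" for v v' w w' :: "complex vec"
    by (rule append_vec_add[where n = p and m = p]; rule carrier_vecI, rule that)
  show ?thesis
    unfolding LMI_blocks block block_mult_vec[OF assms]
    using carrier_vecD[OF u] carrier_vecD[OF a] carrier_vecD[OF c]
    by (simp only: add1 add2 index_add_vec(2) index_smult_vec(2) index_uminus_vec(2)
        dim_mult_mat_vec dim_mat_adjoint dims)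
qed

text \<open>The blocks below the diagonal are adjoint to those above, so each pair contributes twice
  a real part. The multipliers enter affinely, and their coefficients are the two constraint forms
  up to sign.\<close>

lemma LMI_form:
  fixes \<delta>a \<delta>b \<gamma> \<tau>1 \<tau>2 :: real and t :: complex
  assumes u: "u \<in> carrier_vec m" and a: "a \<in> carrier_vec p" and c: "c \<in> carrier_vec p"
  defines "z \<equiv> (vec1 t @\<^sub>v u) @\<^sub>v (a @\<^sub>v c)"
  shows "Re (vherm z (LMI H Hs y ys p \<delta>a \<delta>b \<gamma> x \<tau>1 \<tau>2 *\<^sub>v z)) =
    (\<gamma> + Re (kappa H y)) * (cmod t)\<^sup>2 + 2 * Re (cnj t * (\<delta>a * vherm d a + \<delta>b * vherm b c)) + (vnorm u)\<^sup>2
    + 2 * Re (vherm u (t \<cdot>\<^sub>v res x + (- (\<delta>a \<cdot>\<^sub>v (G x *\<^sub>v a)) + \<delta>b \<cdot>\<^sub>v (Q *\<^sub>v c))))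
    - \<tau>1 * ((cmod t)\<^sup>2 - (vnorm a)\<^sup>2) - \<tau>2 * ((cmod t)\<^sup>2 - (vnorm c)\<^sup>2)"
proof -
  have dim: "dim_vec u = m" "dim_vec a = p" "dim_vec c = p" using assms by auto
  have adj: "vherm a (mat_adjoint (G x) *\<^sub>v u) = cnj (vherm u (G x *\<^sub>v a))"
    "vherm c (mat_adjoint Q *\<^sub>v u) = cnj (vherm u (Q *\<^sub>v c))"
    unfolding vherm_mat_adjoint[OF carriers(3) u a] vherm_mat_adjoint[OF carriers(4) u c]
    by (rule vherm_commute, simp add: dim)+
  have comm: "vherm u (res x) = cnj (vherm (res x) u)" "vherm a d = cnj (vherm d a)" "vherm c b = cnj (vherm b c)"
    by (rule vherm_commute, simp add: dim)+
  have form: "vherm z (LMI H Hs y ys p \<delta>a \<delta>b \<gamma> x \<tau>1 \<tau>2 *\<^sub>v z) =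
      cnj t * ((\<gamma> + kappa H y - \<tau>1 - \<tau>2) * t + vherm (res x) u + (\<delta>a * vherm d a + \<delta>b * vherm b c))
      + (t * cnj (vherm (res x) u) + of_real ((vnorm u)\<^sup>2) + (- (\<delta>a * vherm u (G x *\<^sub>v a)) + \<delta>b * vherm u (Q *\<^sub>v c)))
      + ((\<delta>a * (t * cnj (vherm d a)) - \<delta>a * cnj (vherm u (G x *\<^sub>v a)) + \<tau>1 * of_real ((vnorm a)\<^sup>2))
      + (\<delta>b * (t * cnj (vherm b c)) + \<delta>b * cnj (vherm u (Q *\<^sub>v c)) + \<tau>2 * of_real ((vnorm c)\<^sup>2)))"
    unfolding z_def LMI_mult_vec[OF u a c]
    by (simp add: vherm_append vherm_vec1[simplified] vherm_add_right vherm_smult_right vherm_uminus_right adj comm dim vherm_self)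
  have cross: "vherm u (t \<cdot>\<^sub>v res x + (- (\<delta>a \<cdot>\<^sub>v (G x *\<^sub>v a)) + \<delta>b \<cdot>\<^sub>v (Q *\<^sub>v c))) =
      t * cnj (vherm (res x) u) + (- (\<delta>a * vherm u (G x *\<^sub>v a)) + \<delta>b * vherm u (Q *\<^sub>v c))"
    by (simp add: vherm_add_right vherm_smult_right vherm_uminus_right adj comm dim)
  show ?thesis
    unfolding form cross cmod_power2 using Im_kappa by (simp add: power2_eq_square algebra_simps)
qed

text \<open>Exchanging sums shows that the perturbation of H acts on x as \<open>G x\<close> acts on
  \<alpha>, so the perturbed residual is affine in \<alpha> and \<beta>. The subtracted terms pair
  up with their conjugates.\<close>

lemma Rs_eq:
  assumes x: "x \<in> carrier_vec n" and \<alpha>: "\<alpha> \<in> carrier_vec p" and \<beta>: "\<beta> \<in> carrier_vec p"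
  shows "Rs H Hs y ys p x \<alpha> \<beta> = (vnorm (res x + (- (G x *\<^sub>v \<alpha>) + Q *\<^sub>v \<beta>)))\<^sup>2
    - Re (kappa H y) - 2 * Re (vherm d \<alpha>) - 2 * Re (vherm b \<beta>)"
proof -
  have Htil: "(Htil H Hs p \<alpha> *\<^sub>v x) $ j = (H *\<^sub>v x) $ j + (G x *\<^sub>v \<alpha>) $ j" if j: "j < m" for j
  proof -
    have "(Htil H Hs p \<alpha> *\<^sub>v x) $ j = (\<Sum>k<n. (H $$ (j, k) + (\<Sum>i<p. \<alpha> $ i * Hs i $$ (j, k))) * x $ k)"
      using j x by (simp add: Htil_def scalar_prod_def lessThan_atLeast0)
    also have "\<dots> = (\<Sum>k<n. H $$ (j, k) * x $ k) + (\<Sum>k<n. \<Sum>i<p. \<alpha> $ i * Hs i $$ (j, k) * x $ k)"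
      by (simp add: distrib_right sum.distrib sum_distrib_right)
    also have "(\<Sum>k<n. \<Sum>i<p. \<alpha> $ i * Hs i $$ (j, k) * x $ k) = (\<Sum>i<p. \<Sum>k<n. \<alpha> $ i * Hs i $$ (j, k) * x $ k)"
      by (rule sum.swap)
    also have "\<dots> = (\<Sum>i<p. (\<Sum>k<n. Hs i $$ (j, k) * x $ k) * \<alpha> $ i)"
      by (simp add: sum_distrib_left sum_distrib_right mult_ac)
    also have "\<dots> = (\<Sum>i<p. (Hs i *\<^sub>v x) $ j * \<alpha> $ i)"
      using j x Hs by (intro sum.cong) (auto simp: scalar_prod_def lessThan_atLeast0 dest!: Hs)
    also have "\<dots> = (G x *\<^sub>v \<alpha>) $ j"
      using j \<alpha> by (simp add: scalar_prod_def Gmat_def lessThan_atLeast0)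
    finally show ?thesis
      using j x by (simp add: scalar_prod_def lessThan_atLeast0)
  qed
  have ytil: "ytil y ys p \<beta> $ j = y $ j + (Q *\<^sub>v \<beta>) $ j" if "j < m" for j
    using that \<beta> by (simp add: ytil_def Qmat_def scalar_prod_def lessThan_atLeast0 mult.commute)
  have dimH: "dim_row (Htil H Hs p \<alpha>) = m" and dimy: "dim_vec (ytil y ys p \<beta>) = m"
    by (simp_all add: Htil_def ytil_def)
  have "ytil y ys p \<beta> - Htil H Hs p \<alpha> *\<^sub>v x = res x + (- (G x *\<^sub>v \<alpha>) + Q *\<^sub>v \<beta>)"
  proof (rule eq_vecI)
    fix j assume "j < dim_vec (res x + (- (G x *\<^sub>v \<alpha>) + Q *\<^sub>v \<beta>))"
    then have j: "j < m" by simp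
    show "(ytil y ys p \<beta> - Htil H Hs p \<alpha> *\<^sub>v x) $ j = (res x + (- (G x *\<^sub>v \<alpha>) + Q *\<^sub>v \<beta>)) $ j"
      using Htil[OF j] ytil[OF j] j dimH dimy by (simp del: index_mult_mat_vec)
  qed (simp add: dimH)
  moreover have "vherm \<alpha> d = cnj (vherm d \<alpha>)" "vherm \<beta> b = cnj (vherm b \<beta>)"
    using \<alpha> \<beta> by (auto intro!: vherm_commute)
  ultimately show ?thesis by (simp add: Rs_def)
qed

text \<open>With t a and t c in the last blocks, the cross term of \<open>LMI_form\<close> is 2 Re
  u^H (t w). Completing the square in u leaves -|t w|^2, which supplies the quadratic part of -|t|^2
  times the regret.\<close>

lemma LMI_form_Rs:
  fixes \<delta>a \<delta>b \<gamma> \<tau>1 \<tau>2 :: real and t :: complex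
  assumes x: "x \<in> carrier_vec n" and u: "u \<in> carrier_vec m" and a: "a \<in> carrier_vec p" and c: "c \<in> carrier_vec p"
  defines "w \<equiv> res x + (- (G x *\<^sub>v (\<delta>a \<cdot>\<^sub>v a)) + Q *\<^sub>v (\<delta>b \<cdot>\<^sub>v c))"
  defines "z \<equiv> (vec1 t @\<^sub>v u) @\<^sub>v ((t \<cdot>\<^sub>v a) @\<^sub>v (t \<cdot>\<^sub>v c))"
  shows "Re (vherm z (LMI H Hs y ys p \<delta>a \<delta>b \<gamma> x \<tau>1 \<tau>2 *\<^sub>v z)) =
    (cmod t)\<^sup>2 * (\<gamma> - Rs H Hs y ys p x (\<delta>a \<cdot>\<^sub>v a) (\<delta>b \<cdot>\<^sub>v c)
      - \<tau>1 * (1 - (vnorm a)\<^sup>2) - \<tau>2 * (1 - (vnorm c)\<^sup>2)) + (vnorm (u + t \<cdot>\<^sub>v w))\<^sup>2"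
proof -
  have dim: "dim_vec u = m" "dim_vec a = p" "dim_vec c = p" using assms by auto
  have w: "t \<cdot>\<^sub>v res x + (- (\<delta>a \<cdot>\<^sub>v (G x *\<^sub>v (t \<cdot>\<^sub>v a))) + \<delta>b \<cdot>\<^sub>v (Q *\<^sub>v (t \<cdot>\<^sub>v c))) = t \<cdot>\<^sub>v w"
    unfolding w_def mult_mat_vec[OF carriers(3) a] mult_mat_vec[OF carriers(4) c]
    by (intro eq_vecI) (simp_all del: index_mult_mat_vec add: algebra_simps)
  have norm: "(vnorm (u + t \<cdot>\<^sub>v w))\<^sup>2 = (vnorm u)\<^sup>2 + (cmod t)\<^sup>2 * (vnorm w)\<^sup>2 + 2 * Re (vherm u (t \<cdot>\<^sub>v w))"
    by (subst vnorm_sq_add) (simp_all add: dim w_def vnorm_smult power_mult_distrib)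
  have Rs: "Rs H Hs y ys p x (\<delta>a \<cdot>\<^sub>v a) (\<delta>b \<cdot>\<^sub>v c) =
      (vnorm w)\<^sup>2 - Re (kappa H y) - 2 * (\<delta>a * Re (vherm d a)) - 2 * (\<delta>b * Re (vherm b c))"
    using a c by (subst Rs_eq[OF x]) (simp_all add: w_def vherm_smult_right)
  have cross: "Re (cnj t * (\<delta>a * vherm d (t \<cdot>\<^sub>v a) + \<delta>b * vherm b (t \<cdot>\<^sub>v c))) =
      (cmod t)\<^sup>2 * (\<delta>a * Re (vherm d a) + \<delta>b * Re (vherm b c))"
    by (simp add: vherm_smult_right dim cmod_power2) (simp add: power2_eq_square algebra_simps)
  have form: "Re (vherm z (LMI H Hs y ys p \<delta>a \<delta>b \<gamma> x \<tau>1 \<tau>2 *\<^sub>v z)) =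
    (\<gamma> + Re (kappa H y)) * (cmod t)\<^sup>2 + 2 * Re (cnj t * (\<delta>a * vherm d (t \<cdot>\<^sub>v a) + \<delta>b * vherm b (t \<cdot>\<^sub>v c)))
    + (vnorm u)\<^sup>2 + 2 * Re (vherm u (t \<cdot>\<^sub>v w))
    - \<tau>1 * ((cmod t)\<^sup>2 - (vnorm (t \<cdot>\<^sub>v a))\<^sup>2) - \<tau>2 * ((cmod t)\<^sup>2 - (vnorm (t \<cdot>\<^sub>v c))\<^sup>2)"
    unfolding z_def w[symmetric] using a c by (intro LMI_form u) simp_all
  show ?thesis
    unfolding form norm Rs cross by (simp add: vnorm_smult power_mult_distrib algebra_simps)
qed

text \<open>Forward, the S-lemma supplies the multipliers; backward, the form is evaluated where the
  completed square vanishes.\<close>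

lemma robust_iff_LMI:
  fixes \<delta>a \<delta>b \<gamma> :: real
  assumes x: "x \<in> carrier_vec n" and \<delta>: "0 \<le> \<delta>a" "0 \<le> \<delta>b"
  shows "(\<forall>\<alpha> \<in> carrier_vec p. \<forall>\<beta> \<in> carrier_vec p. vnorm \<alpha> \<le> \<delta>a \<longrightarrow> vnorm \<beta> \<le> \<delta>b \<longrightarrow>
      Rs H Hs y ys p x \<alpha> \<beta> \<le> \<gamma>)
    \<longleftrightarrow> (\<exists>\<tau>1 \<tau>2. \<tau>1 \<ge> 0 \<and> \<tau>2 \<ge> 0 \<and> psd (LMI H Hs y ys p \<delta>a \<delta>b \<gamma> x \<tau>1 \<tau>2))"
    (is "?bound \<longleftrightarrow> ?lmi")
proof
  assume bound: ?bound
  define N where "N = 1 + m + (p + p)"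
  define form where "form = (\<lambda>\<tau>1 \<tau>2 z. Re (vherm z (LMI H Hs y ys p \<delta>a \<delta>b \<gamma> x \<tau>1 \<tau>2 *\<^sub>v z)))"
  \<comment> \<open>The constraint forms are the coefficients of -\<tau>1 and -\<tau>2. Written as
    differences of forms of block matrices, they inherit the Hermitian-map property by
    linearity.\<close>
  define g1 where "g1 = (\<lambda>z. form 0 0 z - form 1 0 z)"
  define g2 where "g2 = (\<lambda>z. form 0 0 z - form 0 1 z)"
  have split: "\<exists>t. \<exists>u\<in>carrier_vec m. \<exists>a\<in>carrier_vec p. \<exists>c\<in>carrier_vec p. z = (vec1 t @\<^sub>v u) @\<^sub>v (a @\<^sub>v c)"
    if "z \<in> carrier_vec N" for z
  proof -
    have "z = (vec_first (vec_first z (1 + m)) 1 @\<^sub>v vec_last (vec_first z (1 + m)) m)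
        @\<^sub>v (vec_first (vec_last z (p + p)) p @\<^sub>v vec_last (vec_last z (p + p)) p)"
      using that by (simp only: N_def vec_first_last_append vec_first_carrier vec_last_carrier)
    moreover obtain t where "vec_first (vec_first z (1 + m)) 1 = vec1 t"
      using vec1_cases[OF vec_first_carrier] by blast
    ultimately show ?thesis by (metis vec_first_carrier vec_last_carrier)
  qed
  have g: "g1 z = (cmod t)\<^sup>2 - (vnorm a)\<^sup>2" "g2 z = (cmod t)\<^sup>2 - (vnorm c)\<^sup>2"
    and affine: "form \<tau>1 \<tau>2 z = form 0 0 z - \<tau>1 * g1 z - \<tau>2 * g2 z"
    if "u \<in> carrier_vec m" "a \<in> carrier_vec p" "c \<in> carrier_vec p" "z = (vec1 t @\<^sub>v u) @\<^sub>v (a @\<^sub>v c)"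
    for t u a c z \<tau>1 \<tau>2
    unfolding g1_def g2_def form_def that(4) LMI_form[OF that(1-3)] by (simp_all add: algebra_simps)
  have "hermitian_map_on (carrier_vec N) (\<lambda>z. (form 0 0 z, form 1 0 z, form 0 1 z))"
    unfolding form_def using LMI_carrier[of \<delta>a \<delta>b \<gamma> x] by (intro hermitian_map_on_forms) (simp_all only: N_def)
  then have "hermitian_map_on (carrier_vec N)
      (\<lambda>z. (\<lambda>(r, s, t). (r, r - s, r - t)) (form 0 0 z, form 1 0 z, form 0 1 z))"
    by (rule hermitian_map_on_linear) (auto intro!: linearI simp: algebra_simps)
  then have herm: "hermitian_map_on (carrier_vec N) (\<lambda>z. (form 0 0 z, g1 z, g2 z))"
    by (simp add: g1_def g2_def)
  have impl: "0 \<le> form 0 0 z" if z: "z \<in> carrier_vec N" and pos: "0 \<le> g1 z" "0 \<le> g2 z" for z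
  proof -
    obtain t u a c where carr: "u \<in> carrier_vec m" "a \<in> carrier_vec p" "c \<in> carrier_vec p"
      and z_eq: "z = (vec1 t @\<^sub>v u) @\<^sub>v (a @\<^sub>v c)"
      using split[OF z] by blast
    \<comment> \<open>Hence a = t a' and c = t c' with a', c' in the unit ball. With both
      multipliers 0, the form is |t|^2 times the gap between \<gamma> and the regret, plus a
      square.\<close>
    have "vnorm a \<le> cmod t" "vnorm c \<le> cmod t"
      using pos g[OF carr z_eq] by (auto intro: power2_le_imp_le)
    then obtain a' c' where a': "a' \<in> carrier_vec p" "a = t \<cdot>\<^sub>v a'" "vnorm a' \<le> 1"
      and c': "c' \<in> carrier_vec p" "c = t \<cdot>\<^sub>v c'" "vnorm c' \<le> 1"
      using vnorm_le_cmodE carr by metis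
    have "vnorm (of_real \<delta>a \<cdot>\<^sub>v a') \<le> \<delta>a" "vnorm (of_real \<delta>b \<cdot>\<^sub>v c') \<le> \<delta>b"
      using \<delta> a'(3) c'(3) by (simp_all add: vnorm_smult mult_left_le)
    then have "Rs H Hs y ys p x (of_real \<delta>a \<cdot>\<^sub>v a') (of_real \<delta>b \<cdot>\<^sub>v c') \<le> \<gamma>"
      using bound a'(1) c'(1) by simp
    then show ?thesis
      unfolding form_def z_eq a'(2) c'(2) LMI_form_Rs[OF x carr(1) a'(1) c'(1)] by simp
  qed
  \<comment> \<open>Slater point: t = 1 with all other blocks zero gives both constraint forms the
    value 1, whatever the radii.\<close>
  define z0 :: "complex vec" where "z0 = (vec1 1 @\<^sub>v 0\<^sub>v m) @\<^sub>v (0\<^sub>v p @\<^sub>v 0\<^sub>v p)"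
  have z0: "z0 \<in> carrier_vec N" unfolding z0_def N_def by (intro append_carrier_vec; simp)
  have "0 < g1 z0" "0 < g2 z0"
    by (subst g[OF _ _ _ z0_def]; simp)+
  then obtain \<tau>1 \<tau>2 where \<tau>: "0 \<le> \<tau>1" "0 \<le> \<tau>2"
    and le: "\<And>z. z \<in> carrier_vec N \<Longrightarrow> \<tau>1 * g1 z + \<tau>2 * g2 z \<le> form 0 0 z"
    using complex_S_lemma[OF herm impl z0] by blast
  have "0 \<le> form \<tau>1 \<tau>2 z" if z: "z \<in> carrier_vec N" for z
  proof -
    obtain t u a c where carr: "u \<in> carrier_vec m" "a \<in> carrier_vec p" "c \<in> carrier_vec p"
      and z_eq: "z = (vec1 t @\<^sub>v u) @\<^sub>v (a @\<^sub>v c)"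
      using split[OF z] by blast
    show ?thesis using affine[OF carr z_eq, of \<tau>1 \<tau>2] le[OF z] by linarith
  qed
  then have "psd (LMI H Hs y ys p \<delta>a \<delta>b \<gamma> x \<tau>1 \<tau>2)"
    using LMI_carrier[of \<delta>a \<delta>b \<gamma> x \<tau>1 \<tau>2] LMI_hermitian
    unfolding psd_def form_def N_def[symmetric] by (metis carrier_matD(1))
  then show ?lmi using \<tau> by blast
next
  assume ?lmi
  then obtain \<tau>1 \<tau>2 where \<tau>: "0 \<le> \<tau>1" "0 \<le> \<tau>2" and psd: "psd (LMI H Hs y ys p \<delta>a \<delta>b \<gamma> x \<tau>1 \<tau>2)"
    by blast
  show ?bound
  proof (intro ballI impI)
    fix \<alpha> \<beta> assume \<alpha>\<beta>: "\<alpha> \<in> carrier_vec p" "\<beta> \<in> carrier_vec p" "vnorm \<alpha> \<le> \<delta>a" "vnorm \<beta> \<le> \<delta>b"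
    obtain a where a: "a \<in> carrier_vec p" "\<alpha> = of_real \<delta>a \<cdot>\<^sub>v a" "vnorm a \<le> 1"
      using vnorm_le_cmodE[OF \<alpha>\<beta>(1), of "of_real \<delta>a"] \<alpha>\<beta>(3) \<delta>(1) by auto
    obtain c where c: "c \<in> carrier_vec p" "\<beta> = of_real \<delta>b \<cdot>\<^sub>v c" "vnorm c \<le> 1"
      using vnorm_le_cmodE[OF \<alpha>\<beta>(2), of "of_real \<delta>b"] \<alpha>\<beta>(4) \<delta>(2) by auto
    define w where "w = res x + (- (G x *\<^sub>v (of_real \<delta>a \<cdot>\<^sub>v a)) + Q *\<^sub>v (of_real \<delta>b \<cdot>\<^sub>v c))"
    have w: "dim_vec w = m" by (simp add: w_def)
    \<comment> \<open>The choice t = 1, u = -w annihilates the completed square.\<close>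
    define z where "z = (vec1 1 @\<^sub>v - w) @\<^sub>v ((1 \<cdot>\<^sub>v a) @\<^sub>v (1 \<cdot>\<^sub>v c))"
    have "z \<in> carrier_vec (1 + m + (p + p))"
      unfolding z_def using w a c by (intro append_carrier_vec carrier_vecI; simp)
    then have "0 \<le> Re (vherm z (LMI H Hs y ys p \<delta>a \<delta>b \<gamma> x \<tau>1 \<tau>2 *\<^sub>v z))"
      using psd LMI_carrier[of \<delta>a \<delta>b \<gamma> x \<tau>1 \<tau>2] unfolding psd_def by auto
    also have "\<dots> = \<gamma> - Rs H Hs y ys p x \<alpha> \<beta> - \<tau>1 * (1 - (vnorm a)\<^sup>2) - \<tau>2 * (1 - (vnorm c)\<^sup>2)
        + (vnorm (- w + 1 \<cdot>\<^sub>v w))\<^sup>2"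
      unfolding z_def using w by (subst LMI_form_Rs[OF x _ a(1) c(1)]) (auto simp: a(2) c(2) w_def intro: carrier_vecI)
    also have "- w + 1 \<cdot>\<^sub>v w = 0\<^sub>v m"
      using w by (intro eq_vecI) auto
    finally have "Rs H Hs y ys p x \<alpha> \<beta> + \<tau>1 * (1 - (vnorm a)\<^sup>2) + \<tau>2 * (1 - (vnorm c)\<^sup>2) \<le> \<gamma>"
      by simp
    moreover have "0 \<le> \<tau>1 * (1 - (vnorm a)\<^sup>2)" "0 \<le> \<tau>2 * (1 - (vnorm c)\<^sup>2)"
      using \<tau> a(3) c(3) by (auto intro!: mult_nonneg_nonneg simp: power_le_one vnorm_nonneg)
    ultimately show "Rs H Hs y ys p x \<alpha> \<beta> \<le> \<gamma>" by linarith
  qed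
qed

end

section \<open>Attainment of the minimum\<close>

context regret_data
begin

lemma Rs_tendsto:
  assumes X: "\<And>k. X k \<in> carrier_vec n" and x: "x \<in> carrier_vec n"
    and lim: "\<And>i. i < n \<Longrightarrow> (\<lambda>k. X k $ i) \<longlonglongrightarrow> x $ i"
  shows "(\<lambda>k. Rs H Hs y ys p (X k) \<alpha> \<beta>) \<longlonglongrightarrow> Rs H Hs y ys p x \<alpha> \<beta>"
proof -
  have dim: "dim_row (Htil H Hs p \<alpha>) = m" "dim_col (Htil H Hs p \<alpha>) = n" by (simp_all add: Htil_def)
  have expand: "(vnorm (ytil y ys p \<beta> - Htil H Hs p \<alpha> *\<^sub>v z))\<^sup>2 =
      (\<Sum>j<m. (cmod (ytil y ys p \<beta> $ j - (\<Sum>i<n. Htil H Hs p \<alpha> $$ (j, i) * z $ i)))\<^sup>2)"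
    if "z \<in> carrier_vec n" for z
    unfolding vnorm_sq using that dim by (simp add: scalar_prod_def lessThan_atLeast0)
  show ?thesis
    unfolding Rs_def expand[OF X] expand[OF x] by (intro tendsto_intros lim) simp
qed

lemma Rs_zero:
  assumes x: "x \<in> carrier_vec n"
  shows "Rs H Hs y ys p x (0\<^sub>v p) (0\<^sub>v p) = (vnorm (res x))\<^sup>2 - Re (kappa H y)"
proof -
  have "res x + (- (G x *\<^sub>v 0\<^sub>v p) + Q *\<^sub>v 0\<^sub>v p) = res x"
    by (intro eq_vecI) (auto simp: scalar_prod_def)
  then show ?thesis using x by (subst Rs_eq) (simp_all add: vherm_def)
qed

text \<open>Ensures that the real \<open>Sup\<close> in \<open>WCRs\<close> is taken over a set
  bounded above. The factors 2 and 4 in the bound come from applying \<open>vnorm_sq_add_le\<close>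
  twice.\<close>

lemma Rs_bounded:
  assumes x: "x \<in> carrier_vec n"
  obtains B where "\<And>\<alpha> \<beta>. \<alpha> \<in> carrier_vec p \<Longrightarrow> \<beta> \<in> carrier_vec p \<Longrightarrow> vnorm \<alpha> \<le> \<delta>a \<Longrightarrow> vnorm \<beta> \<le> \<delta>b
    \<Longrightarrow> Rs H Hs y ys p x \<alpha> \<beta> \<le> B"
proof -
  obtain KG where KG: "0 \<le> KG" "\<And>v. v \<in> carrier_vec p \<Longrightarrow> vnorm (G x *\<^sub>v v) \<le> KG * vnorm v"
    using vnorm_mult_mat_vec_bound[OF carriers(3)] by blast
  obtain KQ where KQ: "0 \<le> KQ" "\<And>v. v \<in> carrier_vec p \<Longrightarrow> vnorm (Q *\<^sub>v v) \<le> KQ * vnorm v"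
    using vnorm_mult_mat_vec_bound[OF carriers(4)] by blast
  obtain Kd where Kd: "0 \<le> Kd" "\<And>v. v \<in> carrier_vec p \<Longrightarrow> cmod (vherm d v) \<le> Kd * vnorm v"
    using vherm_bound[OF carriers(1)] by blast
  obtain Kb where Kb: "0 \<le> Kb" "\<And>v. v \<in> carrier_vec p \<Longrightarrow> cmod (vherm b v) \<le> Kb * vnorm v"
    using vherm_bound[OF carriers(2)] by blast
  show ?thesis
  proof (rule that)
    fix \<alpha> \<beta> assume carr: "\<alpha> \<in> carrier_vec p" "\<beta> \<in> carrier_vec p" and le: "vnorm \<alpha> \<le> \<delta>a" "vnorm \<beta> \<le> \<delta>b"
    have bound: "K * vnorm v \<le> K * \<delta>" if "0 \<le> K" "vnorm v \<le> \<delta>" for K \<delta> v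
      using that by (simp add: mult_left_mono)
    have "(vnorm (G x *\<^sub>v \<alpha>))\<^sup>2 \<le> (KG * \<delta>a)\<^sup>2" "(vnorm (Q *\<^sub>v \<beta>))\<^sup>2 \<le> (KQ * \<delta>b)\<^sup>2"
      using KG(2)[OF carr(1)] bound[OF KG(1) le(1)] KQ(2)[OF carr(2)] bound[OF KQ(1) le(2)]
      by (auto intro!: power_mono vnorm_nonneg)
    moreover have "\<bar>Re (vherm d \<alpha>)\<bar> \<le> Kd * \<delta>a" "\<bar>Re (vherm b \<beta>)\<bar> \<le> Kb * \<delta>b"
      using abs_Re_le_cmod[of "vherm d \<alpha>"] Kd(2)[OF carr(1)] bound[OF Kd(1) le(1)]
        abs_Re_le_cmod[of "vherm b \<beta>"] Kb(2)[OF carr(2)] bound[OF Kb(1) le(2)] by linarith+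
    moreover have "(vnorm (res x + (- (G x *\<^sub>v \<alpha>) + Q *\<^sub>v \<beta>)))\<^sup>2 \<le>
        2 * (vnorm (res x))\<^sup>2 + 2 * (vnorm (- (G x *\<^sub>v \<alpha>) + Q *\<^sub>v \<beta>))\<^sup>2"
      by (rule vnorm_sq_add_le) simp
    moreover have "(vnorm (- (G x *\<^sub>v \<alpha>) + Q *\<^sub>v \<beta>))\<^sup>2 \<le>
        2 * (vnorm (- (G x *\<^sub>v \<alpha>)))\<^sup>2 + 2 * (vnorm (Q *\<^sub>v \<beta>))\<^sup>2"
      by (rule vnorm_sq_add_le) simp
    ultimately show "Rs H Hs y ys p x \<alpha> \<beta> \<le> 2 * (vnorm (res x))\<^sup>2 + 4 * (KG * \<delta>a)\<^sup>2 + 4 * (KQ * \<delta>b)\<^sup>2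
        - Re (kappa H y) + 2 * (Kd * \<delta>a) + 2 * (Kb * \<delta>b)"
      unfolding Rs_eq[OF x carr] vnorm_uminus by linarith
  qed
qed

text \<open>The zero perturbation makes the set of regrets nonempty and \<open>Rs_bounded\<close>
  bounds it, so its \<open>Sup\<close> is a genuine least upper bound.\<close>

lemma WCRs_le_iff:
  assumes x: "x \<in> carrier_vec n" and \<delta>: "0 \<le> \<delta>a" "0 \<le> \<delta>b"
  shows "WCRs H Hs y ys p \<delta>a \<delta>b x \<le> \<gamma> \<longleftrightarrow>
    (\<forall>\<alpha> \<in> carrier_vec p. \<forall>\<beta> \<in> carrier_vec p. vnorm \<alpha> \<le> \<delta>a \<longrightarrow> vnorm \<beta> \<le> \<delta>b \<longrightarrow>
      Rs H Hs y ys p x \<alpha> \<beta> \<le> \<gamma>)"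
proof -
  let ?S = "{Rs H Hs y ys p x \<alpha> \<beta> | \<alpha> \<beta>.
      \<alpha> \<in> carrier_vec p \<and> \<beta> \<in> carrier_vec p \<and> vnorm \<alpha> \<le> \<delta>a \<and> vnorm \<beta> \<le> \<delta>b}"
  have "Rs H Hs y ys p x (0\<^sub>v p) (0\<^sub>v p) \<in> ?S" using \<delta> by (auto intro!: exI[of _ "0\<^sub>v p"])
  then have "?S \<noteq> {}" by blast
  moreover have "bdd_above ?S"
    using Rs_bounded[OF x, of \<delta>a \<delta>b] unfolding bdd_above_def by (smt (verit) mem_Collect_eq)
  ultimately show ?thesis
    unfolding WCRs_def by (subst cSup_le_iff) auto
qed

text \<open>Coercivity: the left inverse H^+ recovers x from H x = y - \<open>res x\<close>, so a
  bounded residual bounds x.\<close>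

lemma vnorm_le_residual:
  obtains K where "0 \<le> K"
    "\<And>x. x \<in> carrier_vec n \<Longrightarrow> vnorm x \<le> K * sqrt (2 * (vnorm y)\<^sup>2 + 2 * (vnorm (res x))\<^sup>2)"
proof -
  note pinv = mp_pinv_full_column_rank[OF H rank]
  obtain K where K: "0 \<le> K" "\<And>v. v \<in> carrier_vec m \<Longrightarrow> vnorm (mp_pinv H *\<^sub>v v) \<le> K * vnorm v"
    using vnorm_mult_mat_vec_bound[OF pinv(1)] by blast
  show ?thesis
  proof (rule that[OF K(1)])
    fix x :: "complex vec" assume x: "x \<in> carrier_vec n"
    have Hx: "H *\<^sub>v x \<in> carrier_vec m" using H x by simp
    have "x = mp_pinv H *\<^sub>v (H *\<^sub>v x)"
      using assoc_mult_mat_vec[OF pinv(1) H x] pinv(2) x by simp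
    then have "vnorm x \<le> K * vnorm (H *\<^sub>v x)" using K(2)[OF Hx] by simp
    also have "H *\<^sub>v x = y + - res x"
      using y Hx by (intro eq_vecI) auto
    also have "(vnorm (y + - res x))\<^sup>2 \<le> 2 * (vnorm y)\<^sup>2 + 2 * (vnorm (- res x))\<^sup>2"
      by (rule vnorm_sq_add_le) simp
    then have "K * vnorm (y + - res x) \<le> K * sqrt (2 * (vnorm y)\<^sup>2 + 2 * (vnorm (res x))\<^sup>2)"
      using K(1) by (intro mult_left_mono real_le_rsqrt) simp_all
    finally show "vnorm x \<le> K * sqrt (2 * (vnorm y)\<^sup>2 + 2 * (vnorm (res x))\<^sup>2)" .
  qed
qed

text \<open>Direct method: a minimising sequence is bounded by coercivity, and the limit of a
  convergent subsequence is a minimiser.\<close>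

lemma WCRs_attains_min:
  assumes \<delta>: "0 \<le> \<delta>a" "0 \<le> \<delta>b"
  obtains x0 where "x0 \<in> carrier_vec n"
    "\<And>x. x \<in> carrier_vec n \<Longrightarrow> WCRs H Hs y ys p \<delta>a \<delta>b x0 \<le> WCRs H Hs y ys p \<delta>a \<delta>b x"
proof -
  define f where "f = WCRs H Hs y ys p \<delta>a \<delta>b"
  have Rs_le: "Rs H Hs y ys p x \<alpha> \<beta> \<le> f x"
    if "x \<in> carrier_vec n" "\<alpha> \<in> carrier_vec p" "\<beta> \<in> carrier_vec p" "vnorm \<alpha> \<le> \<delta>a" "vnorm \<beta> \<le> \<delta>b" for x \<alpha> \<beta>
    using WCRs_le_iff[OF that(1) \<delta>, of "f x"] that by (simp add: f_def)
  \<comment> \<open>The zero perturbation is admissible, so the worst case dominates the nominal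
    regret. This yields both the lower bound on \<open>f\<close> and the bound on the minimising
    sequence.\<close>
  have residual: "(vnorm (res x))\<^sup>2 \<le> f x + Re (kappa H y)" if "x \<in> carrier_vec n" for x
    using Rs_le[OF that, of "0\<^sub>v p" "0\<^sub>v p"] \<delta> Rs_zero[OF that] by simp
  define I where "I = Inf (f ` carrier_vec n)"
  have bdd: "bdd_below (f ` carrier_vec n)"
  proof (rule bdd_belowI2)
    fix x :: "complex vec" assume "x \<in> carrier_vec n"
    from residual[OF this] show "- Re (kappa H y) \<le> f x" using zero_le_power2[of "vnorm (res x)"] by linarith
  qed
  have "\<exists>x\<in>carrier_vec n. f x < I + 1 / real (Suc k)" for k
  proof -
    have "f ` carrier_vec n \<noteq> {}" using zero_carrier_vec by blast
    then show ?thesis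
      using cInf_lessD[of "f ` carrier_vec n" "I + 1 / real (Suc k)"] by (auto simp: I_def)
  qed
  then obtain X where X: "\<And>k. X k \<in> carrier_vec n" and fX: "\<And>k. f (X k) < I + 1 / real (Suc k)"
    by metis
  obtain K where K: "0 \<le> K"
    "\<And>x. x \<in> carrier_vec n \<Longrightarrow> vnorm x \<le> K * sqrt (2 * (vnorm y)\<^sup>2 + 2 * (vnorm (res x))\<^sup>2)"
    using vnorm_le_residual by blast
  have bound: "vnorm (X k) \<le> K * sqrt (2 * (vnorm y)\<^sup>2 + 2 * (I + 1 + Re (kappa H y)))" for k
  proof -
    have "1 / real (Suc k) \<le> 1" by simp
    then have "(vnorm (res (X k)))\<^sup>2 \<le> I + 1 + Re (kappa H y)"
      using residual[OF X, of k] fX[of k] by linarith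
    then have "K * sqrt (2 * (vnorm y)\<^sup>2 + 2 * (vnorm (res (X k)))\<^sup>2)
        \<le> K * sqrt (2 * (vnorm y)\<^sup>2 + 2 * (I + 1 + Re (kappa H y)))"
      using K(1) by (intro mult_left_mono real_sqrt_le_mono) simp_all
    with K(2)[OF X, of k] show ?thesis by linarith
  qed
  obtain x0 r where x0: "x0 \<in> carrier_vec n" and r: "strict_mono r"
    and lim: "\<forall>i<n. (\<lambda>k. X (r k) $ i) \<longlonglongrightarrow> x0 $ i"
    by (rule bounded_vec_seq_convergent_subseq[where X = X, OF X bound])
  \<comment> \<open>Lower semicontinuity of a supremum: the limit is taken for each fixed admissible
    pair \<alpha>, \<beta>, using continuity of that single regret in x.\<close>
  have "f x0 \<le> I"
    unfolding f_def WCRs_le_iff[OF x0 \<delta>]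
  proof (intro ballI impI)
    fix \<alpha> \<beta> assume feas: "\<alpha> \<in> carrier_vec p" "\<beta> \<in> carrier_vec p" "vnorm \<alpha> \<le> \<delta>a" "vnorm \<beta> \<le> \<delta>b"
    have "(\<lambda>k. 1 / real (Suc (r k))) \<longlonglongrightarrow> 0"
      using LIMSEQ_subseq_LIMSEQ[OF LIMSEQ_inverse_real_of_nat r] by (simp add: o_def inverse_eq_divide)
    then have "(\<lambda>k. I + 1 / real (Suc (r k))) \<longlonglongrightarrow> I + 0"
      by (intro tendsto_intros)
    moreover have "(\<lambda>k. Rs H Hs y ys p (X (r k)) \<alpha> \<beta>) \<longlonglongrightarrow> Rs H Hs y ys p x0 \<alpha> \<beta>"
      using lim by (intro Rs_tendsto X x0) simp
    moreover have "Rs H Hs y ys p (X (r k)) \<alpha> \<beta> \<le> I + 1 / real (Suc (r k))" for k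
      using Rs_le[OF X feas, of "r k"] fX[of "r k"] by linarith
    ultimately have "Rs H Hs y ys p x0 \<alpha> \<beta> \<le> I + 0"
      by (intro LIMSEQ_le) auto
    then show "Rs H Hs y ys p x0 \<alpha> \<beta> \<le> I" by simp
  qed
  then have "f x0 \<le> f x" if "x \<in> carrier_vec n" for x
    using cInf_lower[OF _ bdd, of "f x"] that unfolding I_def by force
  then show ?thesis using that[OF x0] by (simp add: f_def)
qed

end

section \<open>The equivalence and the optimal value\<close>

theorem theorem3:
  fixes m n p :: nat and H :: "complex mat" and Hs :: "nat \<Rightarrow> complex mat"
    and y :: "complex vec" and ys :: "nat \<Rightarrow> complex vec" and \<delta>a \<delta>b :: real
  assumes "m \<ge> n"
    and "H \<in> carrier_mat m n" and "\<And>i. i < p \<Longrightarrow> Hs i \<in> carrier_mat m n"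
    and "vec_space.rank m (H :: complex mat) = n"
    and "y \<in> carrier_vec m" and "\<And>i. i < p \<Longrightarrow> ys i \<in> carrier_vec m"
    and "\<delta>a \<ge> 0" and "\<delta>b \<ge> 0"
  shows "(\<forall>x \<in> carrier_vec n. \<forall>\<gamma>::real.
           (\<forall>\<alpha> \<in> carrier_vec p. \<forall>\<beta> \<in> carrier_vec p. vnorm \<alpha> \<le> \<delta>a \<longrightarrow> vnorm \<beta> \<le> \<delta>b \<longrightarrow>
               Rs H Hs y ys p x \<alpha> \<beta> \<le> \<gamma>)
           \<longleftrightarrow> (\<exists>\<tau>1 \<tau>2. \<tau>1 \<ge> 0 \<and> \<tau>2 \<ge> 0 \<and> psd (LMI H Hs y ys p \<delta>a \<delta>b \<gamma> x \<tau>1 \<tau>2)))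
       \<and> (\<exists>x0 \<in> carrier_vec n.
           (\<forall>x \<in> carrier_vec n. WCRs H Hs y ys p \<delta>a \<delta>b x0 \<le> WCRs H Hs y ys p \<delta>a \<delta>b x)
           \<and> WCRs H Hs y ys p \<delta>a \<delta>b x0 =
             Inf {\<gamma>. \<exists>x \<in> carrier_vec n. \<exists>\<tau>1 \<tau>2. \<tau>1 \<ge> 0 \<and> \<tau>2 \<ge> 0 \<and>
                        psd (LMI H Hs y ys p \<delta>a \<delta>b \<gamma> x \<tau>1 \<tau>2)})"
proof -
  interpret regret_data m n p H Hs y ys
    using assms by unfold_locales
  obtain x0 where x0: "x0 \<in> carrier_vec n"
    and min: "\<And>x. x \<in> carrier_vec n \<Longrightarrow> WCRs H Hs y ys p \<delta>a \<delta>b x0 \<le> WCRs H Hs y ys p \<delta>a \<delta>b x"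
    using WCRs_attains_min assms(7,8) by blast
  have lmi: "(\<exists>\<tau>1 \<tau>2. \<tau>1 \<ge> 0 \<and> \<tau>2 \<ge> 0 \<and> psd (LMI H Hs y ys p \<delta>a \<delta>b \<gamma> x \<tau>1 \<tau>2))
      \<longleftrightarrow> WCRs H Hs y ys p \<delta>a \<delta>b x \<le> \<gamma>" if "x \<in> carrier_vec n" for x \<gamma>
    using robust_iff_LMI[OF that assms(7,8)] WCRs_le_iff[OF that assms(7,8)] by simp
  \<comment> \<open>For fixed x the feasible \<gamma> form the half-line starting at the worst-case
    regret of x. Because the minimum over x is attained, their union is again a closed half-line,
    whose infimum is its left end.\<close>
  have "{\<gamma>. \<exists>x \<in> carrier_vec n. \<exists>\<tau>1 \<tau>2. \<tau>1 \<ge> 0 \<and> \<tau>2 \<ge> 0 \<and> psd (LMI H Hs y ys p \<delta>a \<delta>b \<gamma> x \<tau>1 \<tau>2)}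
      = {WCRs H Hs y ys p \<delta>a \<delta>b x0..}"
  proof (rule Set.set_eqI)
    fix \<gamma>
    have "(\<exists>x \<in> carrier_vec n. \<exists>\<tau>1 \<tau>2. \<tau>1 \<ge> 0 \<and> \<tau>2 \<ge> 0 \<and> psd (LMI H Hs y ys p \<delta>a \<delta>b \<gamma> x \<tau>1 \<tau>2))
        \<longleftrightarrow> (\<exists>x \<in> carrier_vec n. WCRs H Hs y ys p \<delta>a \<delta>b x \<le> \<gamma>)"
      by (intro bex_cong refl lmi)
    also have "\<dots> \<longleftrightarrow> WCRs H Hs y ys p \<delta>a \<delta>b x0 \<le> \<gamma>"
      by (meson x0 min order_trans)
    finally show "\<gamma> \<in> {\<gamma>. \<exists>x \<in> carrier_vec n. \<exists>\<tau>1 \<tau>2. \<tau>1 \<ge> 0 \<and> \<tau>2 \<ge> 0 \<and> psd (LMI H Hs y ys p \<delta>a \<delta>b \<gamma> x \<tau>1 \<tau>2)}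
        \<longleftrightarrow> \<gamma> \<in> {WCRs H Hs y ys p \<delta>a \<delta>b x0..}" by simp
  qed
  then have "WCRs H Hs y ys p \<delta>a \<delta>b x0 =
      Inf {\<gamma>. \<exists>x \<in> carrier_vec n. \<exists>\<tau>1 \<tau>2. \<tau>1 \<ge> 0 \<and> \<tau>2 \<ge> 0 \<and> psd (LMI H Hs y ys p \<delta>a \<delta>b \<gamma> x \<tau>1 \<tau>2)}"
    by simp
  then show ?thesis
    by (intro conjI ballI allI bexI[OF _ x0] robust_iff_LMI[OF _ assms(7,8)] min)
qed

end
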